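(* Let $T$ be a tree of infinite motion $m$ with $\Delta(T)\le 2^m$. If $T$ contains a double ray, then $a(T)=2^{|T|}$.
   Context: A double ray is a two-way infinite path. $\Delta(T)$ is the least upper bound of the vertex degrees of $T$. The motion of a graph is the least number of vertices moved by a non-identity automorphism; by convention an asymmetric graph has motion larger than every cardinal. A set $S\subseteq V(T)$ is asymmetrizing if the identity is the only automorphism of $T$ mapping $S$ onto itself; two asymmetrizing sets $S,S'$ are equivalent if some automorphism $\varphi$ of $T$ has $\varphi(S)=S'$; $a(T)$ is the number of pairwise inequivalent asymmetrizing sets of $T$. *)

theory Defs
  imports Main
begin

unbundle cardinal_syntax

text \<open>
  Cardinal numbers are rendered by the cardinal orders of the library: \<open>|A|\<close> is a cardinal order
  on \<open>A\<close>, and \<open>=o\<close>, \<open>\<le>o\<close> compare cardinals, also across types.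
\<close>

section \<open>Graphs and trees\<close>

record 'v graph =
  verts :: "'v set"
  adj :: "'v \<Rightarrow> 'v \<Rightarrow> bool"

definition simple_graph :: "'v graph \<Rightarrow> bool" where
  "simple_graph G \<longleftrightarrow>
     (\<forall>u v. adj G u v \<longrightarrow> u \<in> verts G \<and> v \<in> verts G \<and> u \<noteq> v \<and> adj G v u)"

definition is_path :: "'v graph \<Rightarrow> 'v list \<Rightarrow> bool" where
  "is_path G p \<longleftrightarrow> p \<noteq> [] \<and> distinct p \<and> set p \<subseteq> verts G \<and> successively (adj G) p"

definition is_cycle :: "'v graph \<Rightarrow> 'v list \<Rightarrow> bool" where
  "is_cycle G p \<longleftrightarrow> is_path G p \<and> length p \<ge> 3 \<and> adj G (last p) (hd p)"

definition connected_graph :: "'v graph \<Rightarrow> bool" where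
  "connected_graph G \<longleftrightarrow>
     (\<forall>u\<in>verts G. \<forall>v\<in>verts G. \<exists>p. is_path G p \<and> hd p = u \<and> last p = v)"

definition tree :: "'v graph \<Rightarrow> bool" where
  "tree T \<longleftrightarrow>
     simple_graph T \<and> verts T \<noteq> {} \<and> connected_graph T \<and> \<not> (\<exists>p. is_cycle T p)"

definition is_double_ray :: "'v graph \<Rightarrow> (int \<Rightarrow> 'v) \<Rightarrow> bool" where
  "is_double_ray G r \<longleftrightarrow>
     inj r \<and> range r \<subseteq> verts G \<and> (\<forall>i. adj G (r i) (r (i + 1)))"

section \<open>Least cardinals and the maximum degree\<close>

definition least_card :: "'a rel set \<Rightarrow> 'a rel" where
  "least_card R = (SOME r. r \<in> R \<and> (\<forall>r'\<in>R. r \<le>o r'))"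

lemma least_card:
  assumes "R \<noteq> {}" and "\<And>r. r \<in> R \<Longrightarrow> Card_order r"
  shows "least_card R \<in> R \<and> (\<forall>r'\<in>R. least_card R \<le>o r')"
proof -
  have "\<exists>r. r \<in> R \<and> (\<forall>r'\<in>R. r \<le>o r')"
    using exists_minim_Card_order[of R] assms by blast
  then show ?thesis
    unfolding least_card_def by (rule someI_ex)
qed

definition degree :: "'v graph \<Rightarrow> 'v \<Rightarrow> 'v rel" where
  "degree G v = |{u \<in> verts G. adj G v u}|"

text \<open>
  The least upper bound of the degrees. It suffices to consider upper bounds that are cardinals on
  the vertex type, since \<open>|verts G|\<close> is one of them.
\<close>

definition max_degree :: "'v graph \<Rightarrow> 'v rel" where
  "max_degree G = least_card {r. Card_order r \<and> (\<forall>v\<in>verts G. degree G v \<le>o r)}"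

lemma max_degree:
  fixes G :: "'v graph" and r :: "'v rel"
  shows "Card_order (max_degree G)"
    and "v \<in> verts G \<Longrightarrow> degree G v \<le>o max_degree G"
    and "Card_order r \<Longrightarrow> (\<And>v. v \<in> verts G \<Longrightarrow> degree G v \<le>o r) \<Longrightarrow> max_degree G \<le>o r"
proof -
  let ?R = "{r :: 'v rel. Card_order r \<and> (\<forall>v\<in>verts G. degree G v \<le>o r)}"
  have "|verts G| \<in> ?R"
    by (auto simp: degree_def card_of_Card_order intro: card_of_mono1)
  then have "?R \<noteq> {}"
    by blast
  then have *: "max_degree G \<in> ?R \<and> (\<forall>r'\<in>?R. max_degree G \<le>o r')"
    unfolding max_degree_def by (rule least_card) simp
  show "Card_order (max_degree G)"
    and "v \<in> verts G \<Longrightarrow> degree G v \<le>o max_degree G"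
    and "Card_order r \<Longrightarrow> (\<And>v. v \<in> verts G \<Longrightarrow> degree G v \<le>o r) \<Longrightarrow> max_degree G \<le>o r"
    using * by blast+
qed

section \<open>Automorphisms and motion\<close>

text \<open>
  Only the values on \<open>verts G\<close> matter: an automorphism is the identity iff it moves no vertex
  of \<open>G\<close>.
\<close>

definition automorphism :: "'v graph \<Rightarrow> ('v \<Rightarrow> 'v) \<Rightarrow> bool" where
  "automorphism G \<phi> \<longleftrightarrow>
     bij_betw \<phi> (verts G) (verts G) \<and>
     (\<forall>u\<in>verts G. \<forall>v\<in>verts G. adj G (\<phi> u) (\<phi> v) \<longleftrightarrow> adj G u v)"

definition moved :: "'v graph \<Rightarrow> ('v \<Rightarrow> 'v) \<Rightarrow> 'v set" where
  "moved G \<phi> = {v \<in> verts G. \<phi> v \<noteq> v}"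

definition asymmetric :: "'v graph \<Rightarrow> bool" where
  "asymmetric G \<longleftrightarrow> (\<forall>\<phi>. automorphism G \<phi> \<longrightarrow> moved G \<phi> = {})"

text \<open>
  \<open>None\<close> stands for the value larger than every cardinal, the motion of an asymmetric graph.
\<close>

definition motion :: "'v graph \<Rightarrow> 'v rel option" where
  "motion G =
     (if asymmetric G then None
      else Some (least_card {|moved G \<phi>| | \<phi>. automorphism G \<phi> \<and> moved G \<phi> \<noteq> {}}))"

lemma motion_SomeD:
  assumes "motion G = Some m"
  shows "\<exists>\<phi>. automorphism G \<phi> \<and> moved G \<phi> \<noteq> {} \<and> m = |moved G \<phi>|"
    and "automorphism G \<phi> \<Longrightarrow> moved G \<phi> \<noteq> {} \<Longrightarrow> m \<le>o |moved G \<phi>|"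
proof -
  let ?R = "{|moved G \<phi>| | \<phi>. automorphism G \<phi> \<and> moved G \<phi> \<noteq> {}}"
  have m: "m = least_card ?R" and "\<not> asymmetric G"
    using assms by (auto simp: motion_def split: if_splits)
  then have "?R \<noteq> {}"
    by (auto simp: asymmetric_def)
  then have "m \<in> ?R \<and> (\<forall>r'\<in>?R. m \<le>o r')"
    unfolding m by (intro least_card) (auto simp: card_of_Card_order)
  then show "\<exists>\<phi>. automorphism G \<phi> \<and> moved G \<phi> \<noteq> {} \<and> m = |moved G \<phi>|"
    and "automorphism G \<phi> \<Longrightarrow> moved G \<phi> \<noteq> {} \<Longrightarrow> m \<le>o |moved G \<phi>|"
    by blast+
qed

fun infinite_motion :: "'v rel option \<Rightarrow> bool" where
  "infinite_motion None \<longleftrightarrow> True"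
| "infinite_motion (Some m) \<longleftrightarrow> cinfinite m"

text \<open>
  The relation \<open>r \<le> 2\<^sup>m\<close> for a cardinal \<open>r\<close> and a motion \<open>m\<close>; it holds for every \<open>r\<close> if \<open>m\<close> is
  larger than every cardinal.
\<close>

fun le_two_power_motion :: "'a rel \<Rightarrow> 'v rel option \<Rightarrow> bool" where
  "le_two_power_motion r None \<longleftrightarrow> True"
| "le_two_power_motion r (Some m) \<longleftrightarrow> r \<le>o ctwo ^c m"

section \<open>Asymmetrizing sets\<close>

definition asymmetrizing :: "'v graph \<Rightarrow> 'v set \<Rightarrow> bool" where
  "asymmetrizing G S \<longleftrightarrow>
     S \<subseteq> verts G \<and> (\<forall>\<phi>. automorphism G \<phi> \<and> \<phi> ` S = S \<longrightarrow> moved G \<phi> = {})"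

definition asymmetrizing_equiv :: "'v graph \<Rightarrow> 'v set rel" where
  "asymmetrizing_equiv G =
     {(S, S'). asymmetrizing G S \<and> asymmetrizing G S' \<and>
               (\<exists>\<phi>. automorphism G \<phi> \<and> \<phi> ` S = S')}"

lemma automorphism_id: "automorphism G id"
  by (simp add: automorphism_def)

lemma automorphism_comp:
  assumes "automorphism G \<phi>" and "automorphism G \<psi>"
  shows "automorphism G (\<psi> \<circ> \<phi>)"
proof -
  have b: "bij_betw \<phi> (verts G) (verts G)" "bij_betw \<psi> (verts G) (verts G)"
    using assms by (simp_all add: automorphism_def)
  then show ?thesis
    using assms bij_betw_trans[OF b] bij_betwE[OF b(1)] by (simp add: automorphism_def)
qed

lemma automorphism_inv:
  assumes "automorphism G \<phi>"
  shows "automorphism G (inv_into (verts G) \<phi>)"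
proof -
  let ?\<psi> = "inv_into (verts G) \<phi>"
  have b: "bij_betw \<phi> (verts G) (verts G)"
    using assms by (simp add: automorphism_def)
  have b': "bij_betw ?\<psi> (verts G) (verts G)"
    using b by (rule bij_betw_inv_into)
  have "adj G (?\<psi> u) (?\<psi> v) \<longleftrightarrow> adj G u v" if "u \<in> verts G" "v \<in> verts G" for u v
  proof -
    have "adj G (\<phi> (?\<psi> u)) (\<phi> (?\<psi> v)) \<longleftrightarrow> adj G (?\<psi> u) (?\<psi> v)"
      using assms that bij_betwE[OF b'] by (simp add: automorphism_def)
    then show ?thesis
      using that b by (simp add: bij_betw_inv_into_right)
  qed
  with b' show ?thesis
    by (simp add: automorphism_def)
qed

lemma equiv_asymmetrizing_equiv: "equiv {S. asymmetrizing G S} (asymmetrizing_equiv G)"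
proof (rule equivI)
  show "asymmetrizing_equiv G \<subseteq> {S. asymmetrizing G S} \<times> {S. asymmetrizing G S}"
    by (auto simp: asymmetrizing_equiv_def)
  show "refl_on {S. asymmetrizing G S} (asymmetrizing_equiv G)"
    using automorphism_id by (auto simp: refl_on_def asymmetrizing_equiv_def intro!: exI[of _ id])
  show "sym (asymmetrizing_equiv G)"
  proof (rule symI)
    fix S S' assume "(S, S') \<in> asymmetrizing_equiv G"
    then obtain \<phi> where a: "asymmetrizing G S" "asymmetrizing G S'"
      and \<phi>: "automorphism G \<phi>" "\<phi> ` S = S'"
      by (auto simp: asymmetrizing_equiv_def)
    have "inj_on \<phi> (verts G)" "S \<subseteq> verts G"
      using \<phi> a by (auto simp: automorphism_def bij_betw_def asymmetrizing_def)
    then have "inv_into (verts G) \<phi> ` S' = S"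
      using \<phi>(2) by (auto simp: inv_into_image_cancel)
    then show "(S', S) \<in> asymmetrizing_equiv G"
      using a automorphism_inv[OF \<phi>(1)] by (auto simp: asymmetrizing_equiv_def)
  qed
  show "trans (asymmetrizing_equiv G)"
  proof (rule transI)
    fix R S S' assume "(R, S) \<in> asymmetrizing_equiv G" "(S, S') \<in> asymmetrizing_equiv G"
    then obtain \<phi> \<psi> where "automorphism G \<phi>" "\<phi> ` R = S" "automorphism G \<psi>" "\<psi> ` S = S'"
      and a: "asymmetrizing G R" "asymmetrizing G S'"
      by (auto simp: asymmetrizing_equiv_def)
    then have "automorphism G (\<psi> \<circ> \<phi>)" "(\<psi> \<circ> \<phi>) ` R = S'"
      using automorphism_comp by (auto simp: image_comp)
    then show "(R, S') \<in> asymmetrizing_equiv G"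
      using a unfolding asymmetrizing_equiv_def by blast
  qed
qed

text \<open>
  The number of pairwise inequivalent asymmetrizing sets, as the cardinal of the set of
  equivalence classes.
\<close>

definition asymmetrizing_number :: "'v graph \<Rightarrow> 'v set set rel" where
  "asymmetrizing_number G = |{S. asymmetrizing G S} // asymmetrizing_equiv G|"

end

theory Submission
  imports Defs "HOL-Library.Nat_Bijection"
begin

text \<open>
  Root \<open>T\<close> at a vertex \<open>w\<close> of a double ray and call a vertex mobile if some automorphism fixing \<open>w\<close>
  moves it to a sibling. Swapping two branches shows that the branch below a mobile vertex has at
  least \<open>m\<close> vertices. Vertices are distributed among infinitely many channels, invariantly under the
  automorphisms fixing \<open>w\<close>, such that any infinite set of channels meets the branch below \<open>w\<close> or below a
  mobile vertex in a set of full size: on the core (the union of the double rays) the channel is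
  given by the level, and outside, where the tree has no rays, the rigid pieces hanging below
  mobile or core vertices are split evenly. If every mobile branch has at least as many types of
  colourings in a given infinite set of channels as the vertex has siblings, then siblings can be
  separated level by level, each level using its own channels, and one more set of channels remains
  free. That there are at least \<open>2\<^sup>m\<close> types follows by applying this construction to a branch with the
  least number of types. Finally \<open>w\<close> is made recognizable by a pattern on the core, which is
  invariant under all automorphisms of \<open>T\<close>.
\<close>

section \<open>Rooted trees\<close>

text \<open>The root is its own parent, so every iterate of \<open>par\<close> is defined and levels
  along it follow truncated subtraction.\<close>

locale rooted_tree =
  fixes V :: "'v set" and w :: 'v and par :: "'v \<Rightarrow> 'v" and lev :: "'v \<Rightarrow> nat"
  assumes root_in: "w \<in> V"
    and par_root: "par w = w"
    and lev_root: "lev w = 0"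
    and par_in: "v \<in> V \<Longrightarrow> par v \<in> V"
    and lev_Suc: "v \<in> V \<Longrightarrow> v \<noteq> w \<Longrightarrow> lev v = Suc (lev (par v))"
begin

definition desc :: "'v \<Rightarrow> 'v set" where
  "desc x = {v \<in> V. \<exists>k. (par ^^ k) v = x}"

lemma lev_eq_0: "v \<in> V \<Longrightarrow> lev v = 0 \<Longrightarrow> v = w"
  using lev_Suc by fastforce

lemma funpow_par_in: "v \<in> V \<Longrightarrow> (par ^^ k) v \<in> V"
  by (induction k) (auto intro: par_in)

lemma lev_par: "v \<in> V \<Longrightarrow> lev (par v) = lev v - 1"
  using lev_Suc[of v] par_root lev_root by (cases "v = w") auto

lemma lev_funpow: "v \<in> V \<Longrightarrow> lev ((par ^^ k) v) = lev v - k"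
  by (induction k) (auto simp: lev_par funpow_par_in)

lemma desc_subset: "desc x \<subseteq> V"
  by (auto simp: desc_def)

lemma desc_in: "v \<in> desc x \<Longrightarrow> v \<in> V"
  by (auto simp: desc_def)

lemma desc_top_in: "v \<in> desc x \<Longrightarrow> x \<in> V"
  by (auto simp: desc_def intro: funpow_par_in)

lemma desc_refl: "x \<in> V \<Longrightarrow> x \<in> desc x"
  unfolding desc_def using funpow_0[of par x] by blast

lemma desc_trans:
  assumes "u \<in> desc v" "v \<in> desc x"
  shows "u \<in> desc x"
proof -
  obtain j k where "(par ^^ j) u = v" "(par ^^ k) v = x"
    using assms by (auto simp: desc_def)
  then have "(par ^^ (k + j)) u = x"
    by (simp add: funpow_add)
  then show ?thesis
    using assms(1) by (auto simp: desc_def)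
qed

lemma desc_root: "desc w = V"
  using lev_funpow funpow_par_in lev_eq_0 by (fastforce simp: desc_def)

lemma desc_lev: "v \<in> desc x \<Longrightarrow> lev x \<le> lev v"
  by (auto simp: desc_def lev_funpow)

lemma desc_same_level:
  assumes "v \<in> desc x" "v \<in> desc y" "lev x = lev y"
  shows "x = y"
proof -
  obtain k j where kj: "(par ^^ k) v = x" "(par ^^ j) v = y" and v: "v \<in> V"
    using assms by (auto simp: desc_def)
  have l: "lev v - k = lev v - j"
    using assms(3) kj lev_funpow[OF v] by metis
  show ?thesis
  proof (cases "k = j")
    case False
    \<comment> \<open>Different step counts can end at the same level only where truncated
      subtraction stops, that is at the root.\<close>
    then have "lev x = 0" "lev y = 0"
      using l kj lev_funpow[OF v, of k] lev_funpow[OF v, of j] by arith+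
    then show ?thesis
      using lev_eq_0 assms desc_top_in by metis
  qed (use kj in auto)
qed

lemma desc_par:
  assumes "v \<in> desc x" "v \<noteq> x"
  shows "par v \<in> desc x"
proof -
  obtain k where k: "(par ^^ k) v = x" "v \<in> V"
    using assms by (auto simp: desc_def)
  then obtain j where "k = Suc j"
    using assms(2) by (cases k) auto
  then show ?thesis
    using k par_in by (auto simp: desc_def funpow_swap1)
qed

lemma desc_step: "par v \<in> desc x \<Longrightarrow> v \<in> V \<Longrightarrow> v \<in> desc x"
  by (rule desc_trans[of _ "par v"]) (auto simp: desc_def intro!: exI[of _ 1])

lemma desc_child:
  assumes "v \<in> desc x" "v \<noteq> x"
  obtains c where "c \<in> V" "c \<noteq> w" "par c = x" "v \<in> desc c"
proof -
  define k where "k = (LEAST k. (par ^^ k) v = x)"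
  have ex: "\<exists>k. (par ^^ k) v = x" and v: "v \<in> V"
    using assms by (auto simp: desc_def)
  have k: "(par ^^ k) v = x"
    unfolding k_def using ex by (rule LeastI_ex)
  then obtain j where j: "k = Suc j"
    using assms(2) by (cases k) auto
  have "(par ^^ j) v \<noteq> x"
    using not_less_Least[of j "\<lambda>k. (par ^^ k) v = x"] j by (simp add: k_def)
  moreover have p: "par ((par ^^ j) v) = x"
    using k j by simp
  ultimately have "(par ^^ j) v \<noteq> w"
    using par_root by auto
  then show ?thesis
    using that[of "(par ^^ j) v"] p funpow_par_in v by (auto simp: desc_def)
qed

text \<open>If the root lies on a double ray, this is the union of all double rays; see
  \<open>core_iff\<close>.\<close>

definition core :: "'v set" where
  "core = {v. \<exists>s. s 0 = v \<and> (\<forall>n. s n \<in> V \<and> s (Suc n) \<noteq> w \<and> par (s (Suc n)) = s n)}"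

lemma core_in: "v \<in> core \<Longrightarrow> v \<in> V"
  by (auto simp: core_def)

lemma core_child:
  assumes "v \<in> core"
  obtains c where "c \<in> core" "c \<noteq> w" "par c = v"
proof -
  obtain s where s: "s 0 = v" "\<And>n. s n \<in> V \<and> s (Suc n) \<noteq> w \<and> par (s (Suc n)) = s n"
    using assms by (auto simp: core_def)
  have "s 1 \<in> core"
    unfolding core_def using s by (auto intro!: exI[of _ "\<lambda>n. s (Suc n)"])
  then show ?thesis
    using that[of "s 1"] s(1) s(2)[of 0] by auto
qed

lemma core_par:
  assumes "v \<in> core"
  shows "par v \<in> core"
proof (cases "v = w")
  case False
  obtain s where s: "s 0 = v" "\<And>n. s n \<in> V \<and> s (Suc n) \<noteq> w \<and> par (s (Suc n)) = s n"
    using assms by (auto simp: core_def)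
  have "(\<lambda>n. case n of 0 \<Rightarrow> par v | Suc k \<Rightarrow> s k) n \<in> V"
    "(\<lambda>n. case n of 0 \<Rightarrow> par v | Suc k \<Rightarrow> s k) (Suc n) \<noteq> w"
    "par ((\<lambda>n. case n of 0 \<Rightarrow> par v | Suc k \<Rightarrow> s k) (Suc n)) = (\<lambda>n. case n of 0 \<Rightarrow> par v | Suc k \<Rightarrow> s k) n"
    for n using s False par_in core_in[OF assms] by (cases n; metis nat.case)+
  then show ?thesis
    unfolding core_def by (intro CollectI exI[of _ "\<lambda>n. case n of 0 \<Rightarrow> par v | Suc k \<Rightarrow> s k"]) auto
qed (use assms par_root in auto)

lemma core_desc:
  assumes "v \<in> core" "v \<in> desc x"
  shows "x \<in> core"
proof -
  have "(par ^^ k) v \<in> core" for k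
    using assms(1) core_par by (induction k) auto
  then show ?thesis
    using assms(2) by (auto simp: desc_def)
qed

text \<open>Choosing children inside \<open>Y\<close> repeatedly produces a downward ray.\<close>

lemma core_coinduct:
  assumes "x \<in> Y" "Y \<subseteq> V" "\<And>y. y \<in> Y \<Longrightarrow> \<exists>c\<in>Y. c \<noteq> w \<and> par c = y"
  shows "x \<in> core"
proof -
  obtain f where f: "\<And>y. y \<in> Y \<Longrightarrow> f y \<in> Y \<and> f y \<noteq> w \<and> par (f y) = y"
    using assms(3) by metis
  have "(f ^^ n) x \<in> Y" for n
    using assms(1) f by (induction n) auto
  then show ?thesis
    unfolding core_def using f assms(2) by (intro CollectI exI[of _ "\<lambda>n. (f ^^ n) x"]) auto
qed

lemma core_level:
  assumes "v \<in> core"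
  shows "\<exists>u \<in> core \<inter> desc v. lev u = lev v + n"
proof (induction n)
  case 0
  then show ?case using assms desc_refl core_in by auto
next
  case (Suc n)
  then obtain u where u: "u \<in> core" "u \<in> desc v" "lev u = lev v + n"
    by auto
  obtain c where c: "c \<in> core" "c \<noteq> w" "par c = u"
    using core_child[OF u(1)] .
  then have "c \<in> desc v" "lev c = lev v + Suc n"
    using desc_step u core_in lev_Suc by auto
  then show ?case using c by auto
qed

end

section \<open>Groups acting on rooted trees\<close>

text \<open>The intended group is the stabilizer of the root among the automorphisms. Inverses are
  taken on \<open>V\<close>, as values outside \<open>V\<close> are arbitrary.\<close>

locale tree_action = rooted_tree V w par lev
  for V :: "'v set" and w par lev +
  fixes G :: "('v \<Rightarrow> 'v) set"
  assumes act_bij: "g \<in> G \<Longrightarrow> bij_betw g V V"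
    and act_par: "g \<in> G \<Longrightarrow> v \<in> V \<Longrightarrow> g (par v) = par (g v)"
    and id_in: "id \<in> G"
    and comp_in: "f \<in> G \<Longrightarrow> g \<in> G \<Longrightarrow> f \<circ> g \<in> G"
    and inv_in: "g \<in> G \<Longrightarrow> inv_into V g \<in> G"
begin

lemma act_in: "g \<in> G \<Longrightarrow> v \<in> V \<Longrightarrow> g v \<in> V"
  using act_bij bij_betwE by blast

lemma act_inj: "g \<in> G \<Longrightarrow> inj_on g V"
  using act_bij bij_betw_def by blast

lemma act_left_inv: "g \<in> G \<Longrightarrow> v \<in> V \<Longrightarrow> inv_into V g (g v) = v"
  using act_inj by simp

lemma act_right_inv: "g \<in> G \<Longrightarrow> v \<in> V \<Longrightarrow> g (inv_into V g v) = v"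
  using act_bij bij_betw_inv_into_right by fast

text \<open>The root is the only fixed point of \<open>par\<close>, since elsewhere the parent has
  smaller level.\<close>

lemma act_root:
  assumes "g \<in> G"
  shows "g w = w"
proof (rule ccontr)
  assume "g w \<noteq> w"
  then have "lev (g w) = Suc (lev (par (g w)))"
    using lev_Suc act_in assms root_in by blast
  moreover have "par (g w) = g w"
    using act_par[OF assms root_in] par_root by simp
  ultimately show False by simp
qed

lemma act_lev: "g \<in> G \<Longrightarrow> v \<in> V \<Longrightarrow> lev (g v) = lev v"
proof (induction "lev v" arbitrary: v)
  case 0
  then show ?case using lev_eq_0 act_root by metis
next
  case (Suc n)
  then have "v \<noteq> w" using lev_root by auto
  then have "g v \<noteq> w"
    using Suc act_root root_in act_inj inj_onD by metis
  then have "lev (g v) = Suc (lev (g (par v)))"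
    using lev_Suc Suc act_in act_par by metis
  also have "\<dots> = lev v"
    using Suc \<open>v \<noteq> w\<close> lev_Suc par_in by (metis nat.inject)
  finally show ?case .
qed

lemma act_funpow: "g \<in> G \<Longrightarrow> v \<in> V \<Longrightarrow> g ((par ^^ k) v) = (par ^^ k) (g v)"
  by (induction k) (auto simp: act_par funpow_par_in)

lemma act_desc: "g \<in> G \<Longrightarrow> v \<in> desc x \<Longrightarrow> g v \<in> desc (g x)"
  unfolding desc_def using act_funpow act_in by fastforce

lemma act_desc_iff:
  assumes "g \<in> G" "v \<in> V" "x \<in> V"
  shows "g v \<in> desc (g x) \<longleftrightarrow> v \<in> desc x"
  using act_desc[OF assms(1)] act_desc[OF inv_in[OF assms(1)], of "g v" "g x"]
    act_left_inv assms by auto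

lemma act_image_desc:
  assumes "g \<in> G" "S \<subseteq> V" "x \<in> V"
  shows "g ` (S \<inter> desc x) = g ` S \<inter> desc (g x)"
  using act_desc_iff[OF assms(1) _ assms(3)] assms(2) by auto

section \<open>Orbits, siblings and types of colourings\<close>

definition orb :: "'v \<Rightarrow> 'v set" where
  "orb v = {g v |g. g \<in> G}"

lemma orb_refl: "v \<in> orb v"
  unfolding orb_def using id_in by (metis (mono_tags, lifting) CollectI id_apply)

lemma orb_act_subset:
  assumes "g \<in> G"
  shows "orb (g v) \<subseteq> orb v"
proof
  fix y assume "y \<in> orb (g v)"
  then obtain f where "f \<in> G" "y = (f \<circ> g) v"
    by (auto simp: orb_def)
  then show "y \<in> orb v"
    unfolding orb_def using comp_in[OF _ assms] by blast
qed

lemma orb_act: "g \<in> G \<Longrightarrow> v \<in> V \<Longrightarrow> orb (g v) = orb v"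
  using orb_act_subset[of g v] orb_act_subset[OF inv_in, of g "g v"] by (simp add: act_left_inv)

lemma orb_eq: "v \<in> V \<Longrightarrow> y \<in> orb v \<Longrightarrow> orb y = orb v"
  using orb_act by (auto simp: orb_def[of v])

text \<open>An element of \<open>G\<close> that fixes the parent of \<open>x\<close> sends
  \<open>x\<close> into this set, so a colouring that separates siblings at all levels is
  rigid.\<close>

definition sib :: "'v \<Rightarrow> 'v set" where
  "sib x = {y \<in> orb x. par y = par x}"

definition mobile :: "'v \<Rightarrow> bool" where
  "mobile x \<longleftrightarrow> x \<in> V \<and> (\<exists>y \<in> sib x. y \<noteq> x)"

lemma sib_eq: "x \<in> V \<Longrightarrow> y \<in> sib x \<Longrightarrow> sib y = sib x"
  using orb_eq by (auto simp: sib_def)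

lemma sibE:
  assumes "y \<in> sib x"
  obtains g where "g \<in> G" "y = g x" "par y = par x"
  using assms by (auto simp: sib_def orb_def)

lemma sib_in: "x \<in> V \<Longrightarrow> y \<in> sib x \<Longrightarrow> y \<in> V"
  by (metis sibE act_in)

lemma sib_lev: "x \<in> V \<Longrightarrow> y \<in> sib x \<Longrightarrow> lev y = lev x"
  by (metis sibE act_lev)

lemma sib_refl: "x \<in> sib x"
  using orb_refl by (simp add: sib_def)

lemma mobile_act:
  assumes "mobile x" "g \<in> G"
  shows "mobile (g x)"
proof -
  obtain f where f: "f \<in> G" "par (f x) = par x" "f x \<noteq> x" and x: "x \<in> V"
    using assms(1) by (auto simp: mobile_def sib_def orb_def)
  have "g (f x) \<in> orb (g x)"
    unfolding orb_act[OF assms(2) x] using comp_in[OF assms(2) f(1)]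
    by (auto simp: orb_def intro!: exI[of _ "g \<circ> f"])
  moreover have "par (g (f x)) = par (g x)"
    using act_par assms(2) act_in f x by metis
  moreover have "g (f x) \<noteq> g x"
    using act_inj[OF assms(2)] act_in f x by (metis inj_onD)
  ultimately show ?thesis
    using act_in[OF assms(2) x] by (auto simp: mobile_def sib_def)
qed

lemma mobile_act_iff:
  assumes "x \<in> V" "g \<in> G"
  shows "mobile (g x) \<longleftrightarrow> mobile x"
  using mobile_act[OF _ assms(2)] mobile_act[OF _ inv_in[OF assms(2)], of "g x"]
    act_left_inv assms by auto

text \<open>The orbit of a vertex together with a colouring serves as a canonical name of their
  isomorphism class. Such names can be compared between different vertices of one orbit.\<close>

definition ctype :: "'v \<Rightarrow> 'v set \<Rightarrow> ('v \<times> 'v set) set" where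
  "ctype x S = {(g x, g ` S) |g. g \<in> G}"

lemma ctype_act_subset:
  assumes "g \<in> G"
  shows "ctype (g x) (g ` S) \<subseteq> ctype x S"
proof
  fix y assume "y \<in> ctype (g x) (g ` S)"
  then obtain f where "f \<in> G" "y = ((f \<circ> g) x, (f \<circ> g) ` S)"
    by (auto simp: ctype_def image_comp)
  then show "y \<in> ctype x S"
    unfolding ctype_def using comp_in[OF _ assms] by blast
qed

lemma act_image_left_inv: "g \<in> G \<Longrightarrow> S \<subseteq> V \<Longrightarrow> inv_into V g ` g ` S = S"
  using act_inj by (simp add: inv_into_image_cancel)

lemma ctype_act: "g \<in> G \<Longrightarrow> x \<in> V \<Longrightarrow> S \<subseteq> V \<Longrightarrow> ctype (g x) (g ` S) = ctype x S"
  using ctype_act_subset[of g x S] ctype_act_subset[OF inv_in, of g "g x" "g ` S"]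
  by (simp add: act_left_inv act_image_left_inv)

lemma ctype_eqD:
  assumes "ctype x S = ctype y R"
  obtains g where "g \<in> G" "g x = y" "g ` S = R"
proof -
  have "(y, R) \<in> ctype y R"
    unfolding ctype_def using id_in by (intro CollectI exI[of _ id]) simp
  then show ?thesis
    using that unfolding assms[symmetric] by (auto simp: ctype_def)
qed

end

section \<open>Counting colourings supported on a set of channels\<close>

text \<open>Cantor's theorem without the empty set, for at least two elements. The diagonal set
  \<open>d\<close> must be empty, since otherwise it lies in the domain and refutes itself. Hence
  \<open>\<theta> X \<in> X\<close> for every nonempty \<open>X\<close>, and a pair collides with
  one of its singletons.\<close>

lemma not_inj_on_nonempty_subsets:
  assumes inj: "inj_on \<theta> (Pow A - {{}})" and sub: "\<theta> ` (Pow A - {{}}) \<subseteq> A"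
    and ab: "a \<in> A" "b \<in> A" "a \<noteq> b"
  shows False
proof -
  define d where "d = {t \<in> A. \<exists>X \<in> Pow A - {{}}. \<theta> X = t \<and> t \<notin> X}"
  have d_iff: "t \<in> d \<longleftrightarrow> t \<in> A \<and> (\<exists>X \<in> Pow A - {{}}. \<theta> X = t \<and> t \<notin> X)" for t
    by (simp add: d_def)
  have "d = {}"
  proof (rule ccontr)
    assume "d \<noteq> {}"
    then have d: "d \<in> Pow A - {{}}"
      by (auto simp: d_def)
    then have "\<theta> d \<in> A" using sub by auto
    moreover have "X = d" if "X \<in> Pow A - {{}}" "\<theta> X = \<theta> d" for X
      using inj that d by (meson inj_onD)
    ultimately show False
      using d d_iff[of "\<theta> d"] by metis
  qed
  then have fixd: "\<theta> X \<in> X" if "X \<in> Pow A - {{}}" for X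
    using that sub d_iff[of "\<theta> X"] by (metis empty_iff image_subset_iff)
  have "\<theta> {a, b} = \<theta> {a} \<or> \<theta> {a, b} = \<theta> {b}"
    using fixd[of "{a}"] fixd[of "{b}"] fixd[of "{a, b}"] ab by auto
  then have "{a, b} = {a} \<or> {a, b} = {b}"
    using inj_onD[OF inj, of "{a, b}" "{a}"] inj_onD[OF inj, of "{a, b}" "{b}"] ab by auto
  then show False
    using ab by auto
qed

lemma card_of_Pow_mono:
  assumes "|A| \<le>o |B|"
  shows "|Pow A| \<le>o |Pow B|"
proof -
  obtain f where "inj_on f A" "f ` A \<subseteq> B"
    using assms by (meson card_of_ordLeq)
  then show ?thesis
    by (intro card_of_ordLeqI[of "image f"] inj_on_image_Pow) auto
qed

lemma infinite_nat_split:
  assumes "infinite (L :: nat set)"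
  obtains Lf :: "nat \<Rightarrow> nat set"
  where "\<And>i. infinite (Lf i)" "\<And>i. Lf i \<subseteq> L" "\<And>i j. i \<noteq> j \<Longrightarrow> Lf i \<inter> Lf j = {}"
proof -
  obtain f :: "nat \<Rightarrow> nat" where f: "inj f" "range f \<subseteq> L"
    using infinite_countable_subset[OF assms] by auto
  define e where "e i j = f (prod_encode (i, j))" for i j
  have e: "e i j = e i' j' \<longleftrightarrow> i = i' \<and> j = j'" for i j i' j'
    using f(1) by (auto simp: e_def inj_eq)
  show ?thesis
  proof (rule that[of "\<lambda>i. range (e i)"])
    show "infinite (range (e i))" for i
      by (subst finite_image_iff) (auto simp: inj_def e)
  qed (use f e in \<open>auto simp: e_def\<close>)
qed

text \<open>\<open>F\<close> holds the vertices available for colouring, and \<open>h\<close>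
  distributes them among countably many channels. As both are invariant, colourings placed in
  disjoint sets of channels can be read off an image independently.\<close>

locale channels = tree_action V w par lev G
  for V :: "'v set" and w par lev G +
  fixes F :: "'v set" and h :: "'v \<Rightarrow> nat"
  assumes free_subset: "F \<subseteq> V"
    and free_act: "g \<in> G \<Longrightarrow> v \<in> F \<Longrightarrow> g v \<in> F"
    and chan_act: "g \<in> G \<Longrightarrow> v \<in> F \<Longrightarrow> h (g v) = h v"
begin

definition chan :: "nat set \<Rightarrow> 'v set" where
  "chan L = {v \<in> F. h v \<in> L}"

lemma chan_subset: "chan L \<subseteq> V"
  using free_subset by (auto simp: chan_def)

lemma chan_mono: "L \<subseteq> L' \<Longrightarrow> chan L \<subseteq> chan L'"
  by (auto simp: chan_def)

lemma act_image_chan_subset: "g \<in> G \<Longrightarrow> g ` chan L \<subseteq> chan L"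
  using free_act chan_act by (auto simp: chan_def)

lemma act_image_chan:
  assumes "g \<in> G"
  shows "g ` chan L = chan L"
proof
  show "chan L \<subseteq> g ` chan L"
  proof
    fix v assume v: "v \<in> chan L"
    then have "inv_into V g v \<in> chan L"
      using act_image_chan_subset[OF inv_in[OF assms]] by blast
    then show "v \<in> g ` chan L"
      using v chan_subset act_right_inv[OF assms] by (metis image_eqI subsetD)
  qed
qed (rule act_image_chan_subset[OF assms])

definition ctypes :: "nat set \<Rightarrow> 'v \<Rightarrow> ('v \<times> 'v set) set set" where
  "ctypes L x = {ctype x S |S. S \<subseteq> desc x \<inter> chan L}"

lemma ctypes_act_subset:
  assumes "g \<in> G" "x \<in> V"
  shows "ctypes L x \<subseteq> ctypes L (g x)"
proof
  fix t assume "t \<in> ctypes L x"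
  then obtain S where S: "t = ctype x S" "S \<subseteq> desc x \<inter> chan L"
    by (auto simp: ctypes_def)
  then have "t = ctype (g x) (g ` S)"
    using ctype_act assms desc_subset by (metis le_infE subset_trans)
  moreover have "g ` S \<subseteq> desc (g x) \<inter> chan L"
    using S act_desc act_image_chan assms by blast
  ultimately show "t \<in> ctypes L (g x)"
    by (auto simp: ctypes_def)
qed

lemma ctypes_act: "g \<in> G \<Longrightarrow> x \<in> V \<Longrightarrow> ctypes L (g x) = ctypes L x"
  using ctypes_act_subset[of g x] ctypes_act_subset[OF inv_in, of g "g x"] act_in
  by (simp add: act_left_inv subset_antisym)

lemma ctypes_orb: "x \<in> V \<Longrightarrow> y \<in> orb x \<Longrightarrow> ctypes L y = ctypes L x"
  using ctypes_act by (auto simp: orb_def)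

lemma ctypes_nonempty: "ctypes L x \<noteq> {}"
  by (auto simp: ctypes_def)

text \<open>One infinite set of channels is kept free for arbitrary data \<open>A\<close>, and each
  level gets a private infinite set in which siblings receive colourings of different types. An
  automorphism fixing \<open>x\<close> then fixes the branch level by level, after which the data
  can be compared. Treating \<open>A\<close> and \<open>B\<close> at once yields both rigidity and
  inequivalence.\<close>

lemma rigid_extension:
  assumes x: "x \<in> V" and L: "infinite L"
    and room: "\<And>z L'. z \<in> desc x - {x} \<Longrightarrow> mobile z \<Longrightarrow> L' \<subseteq> L \<Longrightarrow> infinite L' \<Longrightarrow>
      |sib z| \<le>o |ctypes L' z|"
  obtains L0 E where "L0 \<subseteq> L" "infinite L0"
    "\<And>A. A \<subseteq> desc x \<inter> chan L0 \<Longrightarrow> E A \<subseteq> desc x \<inter> chan L"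
    "\<And>A B g. \<lbrakk>A \<subseteq> desc x \<inter> chan L0; B \<subseteq> desc x \<inter> chan L0; g \<in> G; g x = x; g ` E A = E B\<rbrakk>
      \<Longrightarrow> A = B \<and> (\<forall>v \<in> desc x. g v = v)"
proof -
  obtain Lf :: "nat \<Rightarrow> nat set" where Lf: "\<And>i. infinite (Lf i)" "\<And>i. Lf i \<subseteq> L" "\<And>i j. i \<noteq> j \<Longrightarrow> Lf i \<inter> Lf j = {}"
    using infinite_nat_split[OF L] by blast
  have disj: "v \<notin> chan (Lf i) \<or> v \<notin> chan (Lf j)" if "i \<noteq> j" for v i j
    using Lf(3)[OF that] by (auto simp: chan_def)
  \<comment> \<open>\<open>Lf 0\<close> carries the data, so the levels use the indices from 1
    on.\<close>
  define ch where "ch z = chan (Lf (Suc (lev z)))" for z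
  \<comment> \<open>The choice depends only on the sibling class, the level and the available types,
    all shared by siblings. So siblings use one common injection (\<open>J_sib\<close>) and draw
    different types from it.\<close>
  define J where "J z = (SOME j. inj_on j (sib z) \<and> j ` sib z \<subseteq> ctypes (Lf (Suc (lev z))) z)" for z
  have J: "inj_on (J z) (sib z) \<and> J z ` sib z \<subseteq> ctypes (Lf (Suc (lev z))) z"
    if z: "z \<in> desc x - {x}" for z
  proof -
    have "|sib z| \<le>o |ctypes (Lf (Suc (lev z))) z|"
    proof (cases "mobile z")
      case True
      then show ?thesis using room z Lf by blast
    next
      case False
      then have "sib z = {z}"
        using sib_refl desc_in z by (auto simp: mobile_def)
      then show ?thesis
        using card_of_singl_ordLeq[OF ctypes_nonempty] by metis
    qed
    then show ?thesis
      unfolding J_def card_of_ordLeq[symmetric] by (rule someI_ex)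
  qed
  have J_sib: "J y = J z" if "z \<in> V" "y \<in> sib z" for y z
  proof -
    have "y \<in> orb z"
      using that(2) by (simp add: sib_def)
    then show ?thesis
      unfolding J_def sib_eq[OF that] sib_lev[OF that] ctypes_orb[OF that(1) \<open>y \<in> orb z\<close>] by simp
  qed
  define P where "P z = (SOME S. S \<subseteq> desc z \<inter> ch z \<and> ctype z S = J z z)" for z
  have P: "P z \<subseteq> desc z \<inter> ch z \<and> ctype z (P z) = J z z" if "z \<in> desc x - {x}" for z
  proof -
    have "J z z \<in> ctypes (Lf (Suc (lev z))) z"
      using J[OF that] sib_refl by blast
    then have "\<exists>S. S \<subseteq> desc z \<inter> ch z \<and> ctype z S = J z z"
      by (auto simp: ctypes_def ch_def)
    then show ?thesis
      unfolding P_def by (rule someI_ex)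
  qed
  have P_inj: "y = z" if "z \<in> desc x - {x}" "y \<in> desc x - {x}" "y \<in> sib z" "ctype y (P y) = ctype z (P z)" for y z
  proof -
    have "J z y = J z z"
      using P that J_sib desc_in by (metis DiffD1)
    then show ?thesis
      using J[OF that(1)] that(3) sib_refl by (meson inj_onD)
  qed
  define E where "E A = A \<union> (\<Union>z \<in> desc x - {x}. P z)" for A
  have E_sub: "E A \<subseteq> desc x \<inter> chan L" if "A \<subseteq> desc x \<inter> chan (Lf 0)" for A
  proof -
    have "P z \<subseteq> desc x \<inter> chan L" if "z \<in> desc x - {x}" for z
      using P[OF that] that desc_trans chan_mono[OF Lf(2)] unfolding ch_def by blast
    then show ?thesis
      using that chan_mono[OF Lf(2)] unfolding E_def by blast
  qed
  have E_0: "E A \<inter> chan (Lf 0) = A" if "A \<subseteq> desc x \<inter> chan (Lf 0)" for A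
  proof
    show "A \<subseteq> E A \<inter> chan (Lf 0)"
      using that by (auto simp: E_def)
    have "v \<notin> P z" if "v \<in> chan (Lf 0)" "z \<in> desc x - {x}" for v z
      using P[OF that(2)] disj[of 0 "Suc (lev z)" v] that(1) by (auto simp: ch_def)
    then show "E A \<inter> chan (Lf 0) \<subseteq> A"
      by (auto simp: E_def)
  qed
  \<comment> \<open>\<open>P z\<close> can be cut out again: sets \<open>P y\<close> at other levels
    use other channels, and those at the same level lie in disjoint branches.\<close>
  have E_P: "E A \<inter> (desc z \<inter> ch z) = P z" if A: "A \<subseteq> desc x \<inter> chan (Lf 0)" and z: "z \<in> desc x - {x}" for A z
  proof
    show "P z \<subseteq> E A \<inter> (desc z \<inter> ch z)"
      using P[OF z] z unfolding E_def by blast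
    show "E A \<inter> (desc z \<inter> ch z) \<subseteq> P z"
    proof
      fix v assume v: "v \<in> E A \<inter> (desc z \<inter> ch z)"
      then have "v \<notin> A"
        using A disj[of 0 "Suc (lev z)" v] by (auto simp: ch_def)
      then obtain y where y: "y \<in> desc x - {x}" "v \<in> P y"
        using v unfolding E_def by blast
      then have "v \<in> desc y" "v \<in> ch y"
        using P by auto
      then have "lev y = lev z"
        using v disj[of "Suc (lev y)" "Suc (lev z)" v] by (auto simp: ch_def)
      then have "y = z"
        using v desc_same_level[OF \<open>v \<in> desc y\<close>] by simp
      then show "v \<in> P z" using y by simp
    qed
  qed
  show ?thesis
  proof (rule that[of "Lf 0" E])
    fix A B g
    assume A: "A \<subseteq> desc x \<inter> chan (Lf 0)" and B: "B \<subseteq> desc x \<inter> chan (Lf 0)"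
      and g: "g \<in> G" "g x = x" "g ` E A = E B"
    have EA: "E A \<subseteq> V"
      using E_sub[OF A] desc_subset by blast
    have img: "g ` (E A \<inter> (S \<inter> S')) = E B \<inter> (g ` S \<inter> g ` S')" if S: "S \<subseteq> V" "S' \<subseteq> V" for S S'
    proof -
      have "S \<inter> S' \<subseteq> V"
        using S by blast
      then show ?thesis
        using inj_on_image_Int[OF act_inj[OF g(1)] EA, of "S \<inter> S'"]
          inj_on_image_Int[OF act_inj[OF g(1)] S] g(3) by simp
    qed
    \<comment> \<open>Induction on the level: once the parent of \<open>v\<close> is fixed,
      \<open>g v\<close> is a sibling of \<open>v\<close>. Since \<open>g\<close> carries
      \<open>P v\<close> to \<open>P (g v)\<close>, both have the same type, and the siblings
      coincide.\<close>
    have fixd: "g v = v" if "v \<in> desc x" for v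
      using that
    proof (induction "lev v" arbitrary: v rule: less_induct)
      case less
      show ?case
      proof (cases "v = x")
        case False
        have v: "v \<in> V" "v \<in> desc x - {x}" "par v \<in> desc x"
          using less.prems desc_in desc_par False by auto
        have "v \<noteq> w"
          using False less.prems desc_lev[of w x] lev_eq_0[of x] x lev_root by force
        then have "g (par v) = par v"
          using less.hyps[OF _ v(3)] lev_Suc v by simp
        then have s: "g v \<in> sib v"
          using act_par[OF g(1) v(1)] g(1) by (auto simp: sib_def orb_def)
        have gx: "g v \<in> desc x - {x}"
          using act_desc[OF g(1), of v x] less.prems g(2) False act_inj[OF g(1)] v x
          by (metis Diff_iff inj_onD singletonD)
        have im: "g ` desc v = desc (g v)"
          using act_image_desc[OF g(1) subset_refl v(1)] act_bij[OF g(1)] desc_subset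
          by (simp add: bij_betw_def Int_absorb1)
        have "g ` P v = g ` (E A \<inter> (desc v \<inter> ch v))"
          using E_P[OF A v(2)] by simp
        also have "\<dots> = E B \<inter> (desc (g v) \<inter> ch (g v))"
          using img[OF desc_subset, of "ch v"] chan_subset act_image_chan[OF g(1)] act_lev[OF g(1) v(1)] im
          by (simp add: ch_def)
        also have "\<dots> = P (g v)"
          using E_P[OF B gx] .
        finally have "ctype (g v) (P (g v)) = ctype v (P v)"
          using ctype_act[OF g(1) v(1), of "P v"] P[OF v(2)] desc_subset by (metis le_infE subset_trans)
        then show ?thesis
          using P_inj[OF v(2) gx s] by simp
      qed (use g in simp)
    qed
    have "g ` A = (\<lambda>v. v) ` A"
      using fixd A by (intro image_cong) auto
    then have "A = g ` A"
      by simp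
    also have "\<dots> = g ` (E A \<inter> (chan (Lf 0) \<inter> chan (Lf 0)))"
      using E_0[OF A] by simp
    also have "\<dots> = B"
      using img[OF chan_subset[of "Lf 0"] chan_subset[of "Lf 0"]] act_image_chan[OF g(1)] E_0[OF B]
      by simp
    finally show "A = B \<and> (\<forall>v \<in> desc x. g v = v)"
      using fixd by blast
  qed (use Lf E_sub in auto)
qed

lemma sib_subset_desc:
  assumes "z \<in> desc x" "z \<noteq> x" "y \<in> sib z"
  shows "y \<in> desc x"
proof -
  have "par y \<in> desc x"
    using desc_par[OF assms(1,2)] assms(3) by (simp add: sib_def)
  then show ?thesis
    using desc_step sib_in[OF desc_in[OF assms(1)] assms(3)] by blast
qed

text \<open>
  Cantor's diagonal argument: a colouring of \<open>desc x\<close> determines the set of types that occur at the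
  images of \<open>z\<close>, and every nonempty small set of types occurs in this way.
\<close>

lemma ctypes_diagonal:
  assumes z: "z \<in> desc x" "z \<noteq> x" and ne: "desc x \<inter> chan L \<noteq> {}"
    and types: "|ctypes L x| \<le>o |ctypes L z|" and few: "|ctypes L x| \<le>o |sib z|"
  shows False
proof -
  have xV: "x \<in> V" and zV: "z \<in> V"
    using z desc_in desc_top_in by auto
  obtain i where i: "inj_on i (ctypes L x)" "i ` ctypes L x \<subseteq> ctypes L z"
    using types by (meson card_of_ordLeq)
  \<comment> \<open>\<open>C\<close> is a copy of the types at \<open>x\<close> among the types at
    \<open>z\<close>, and \<open>Y\<close> consists of the images of \<open>z\<close> below
    \<open>x\<close>. These share a level, so their branches are disjoint and can be coloured
    independently.\<close>
  define C where "C = i ` ctypes L x"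
  define Y where "Y = desc x \<inter> orb z"
  have "sib z \<subseteq> Y"
    using sib_subset_desc z by (auto simp: Y_def sib_def)
  then have "|C| \<le>o |Y|"
    unfolding C_def by (meson card_of_image card_of_mono1 few ordLeq_transitive)
  then obtain p where p: "p ` Y = C"
    using card_of_ordLeq2[of C Y] ctypes_nonempty unfolding C_def by auto
  \<comment> \<open>Types outside \<open>\<A>\<close> are replaced by a default member, so that
    \<open>f \<A>\<close> maps \<open>Y\<close> onto \<open>\<A>\<close> whenever
    \<open>\<A>\<close> is a nonempty subset of \<open>C\<close>.\<close>
  define f where "f \<A> y = (if p y \<in> \<A> then p y else (SOME a. a \<in> \<A>))" for \<A> y
  have f: "f \<A> ` Y = \<A>" if "\<A> \<in> Pow C - {{}}" for \<A>
  proof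
    show "f \<A> ` Y \<subseteq> \<A>"
      using that by (auto simp: f_def some_in_eq)
    show "\<A> \<subseteq> f \<A> ` Y"
    proof
      fix t assume t: "t \<in> \<A>"
      then have "t \<in> p ` Y"
        using that p by blast
      then obtain y where "y \<in> Y" "p y = t"
        by blast
      then show "t \<in> f \<A> ` Y"
        using t by (auto simp: f_def image_iff intro!: bexI[of _ y])
    qed
  qed
  have Y: "y \<in> V" "y \<in> orb z" "lev y = lev z" "ctypes L y = ctypes L z" if "y \<in> Y" for y
    using that desc_in ctypes_orb[OF zV] act_lev zV by (auto simp: Y_def orb_def)
  define Q where "Q t y = (SOME S. S \<subseteq> desc y \<inter> chan L \<and> ctype y S = t)" for t y
  have Q: "Q t y \<subseteq> desc y \<inter> chan L \<and> ctype y (Q t y) = t" if "t \<in> C" "y \<in> Y" for t y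
  proof -
    have "t \<in> ctypes L y"
      using that i Y unfolding C_def by auto
    then have "\<exists>S. S \<subseteq> desc y \<inter> chan L \<and> ctype y S = t"
      by (auto simp: ctypes_def)
    then show ?thesis
      unfolding Q_def by (rule someI_ex)
  qed
  define E where "E \<A> = (\<Union>y \<in> Y. Q (f \<A> y) y)" for \<A>
  have Qf: "Q (f \<A> y) y \<subseteq> desc y \<inter> chan L \<and> ctype y (Q (f \<A> y) y) = f \<A> y"
    if "\<A> \<in> Pow C - {{}}" "y \<in> Y" for \<A> y
    using Q[of "f \<A> y" y] f[OF that(1)] that by blast
  have E_sub: "E \<A> \<subseteq> desc x \<inter> chan L" if "\<A> \<in> Pow C - {{}}" for \<A>
    using Qf[OF that] desc_trans unfolding E_def Y_def by blast
  have E_desc: "E \<A> \<inter> desc y = Q (f \<A> y) y" if "\<A> \<in> Pow C - {{}}" "y \<in> Y" for \<A> y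
  proof
    show "E \<A> \<inter> desc y \<subseteq> Q (f \<A> y) y"
    proof
      fix v assume v: "v \<in> E \<A> \<inter> desc y"
      then obtain y' where y': "y' \<in> Y" "v \<in> Q (f \<A> y') y'"
        unfolding E_def by blast
      then have "y' = y"
        using desc_same_level[of v y' y] v Qf[OF that(1) y'(1)] Y(3) that(2) by auto
      then show "v \<in> Q (f \<A> y) y"
        using y' by simp
    qed
    show "Q (f \<A> y) y \<subseteq> E \<A> \<inter> desc y"
      using Qf[OF that] that(2) unfolding E_def by blast
  qed
  \<comment> \<open>The set of types occurring at \<open>Y\<close> is an invariant of the coloured
    branch: an automorphism matching two such colourings fixes \<open>x\<close>, maps
    \<open>Y\<close> into itself and preserves types.\<close>
  have mono: "\<A> \<subseteq> \<B>" if A: "\<A> \<in> Pow C - {{}}" and B: "\<B> \<in> Pow C - {{}}"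
    and eq: "ctype x (E \<A>) = ctype x (E \<B>)" for \<A> \<B>
  proof
    fix t assume "t \<in> \<A>"
    then have "t \<in> f \<A> ` Y"
      using f[OF A] by simp
    then obtain y where y: "y \<in> Y" "f \<A> y = t"
      by blast
    obtain g where g: "g \<in> G" "g x = x" "g ` E \<A> = E \<B>"
      using ctype_eqD[OF eq] .
    have gy: "g y \<in> Y"
    proof -
      have "g y \<in> orb z"
        using orb_refl[of "g y"] unfolding orb_act[OF g(1) Y(1)[OF y(1)]] orb_eq[OF zV Y(2)[OF y(1)]] .
      then show ?thesis
        using act_desc[OF g(1), of y x] g(2) y(1) by (simp add: Y_def)
    qed
    have E_V: "E \<A> \<subseteq> V"
      using E_sub[OF A] desc_subset by blast
    have "t = ctype y (E \<A> \<inter> desc y)"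
      using E_desc[OF A y(1)] Qf[OF A y(1)] y(2) by simp
    also have "\<dots> = ctype (g y) (g ` (E \<A> \<inter> desc y))"
      using ctype_act[OF g(1) Y(1)[OF y(1)], of "E \<A> \<inter> desc y"] E_V by auto
    also have "\<dots> = ctype (g y) (E \<B> \<inter> desc (g y))"
      using act_image_desc[OF g(1) E_V Y(1)[OF y(1)]] g(3) by simp
    also have "\<dots> = f \<B> (g y)"
      using E_desc[OF B gy] Qf[OF B gy] by simp
    finally show "t \<in> \<B>"
      using f[OF B] gy by blast
  qed
  obtain v where v: "v \<in> desc x \<inter> chan L"
    using ne by blast
  \<comment> \<open>The empty colouring and a single vertex supply the two elements that the
    diagonal lemma requires.\<close>
  have "ctype x {} \<noteq> ctype x {v}"
    by (metis ctype_eqD image_is_empty insert_not_empty)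
  moreover have "ctype x {} \<in> ctypes L x" "ctype x {v} \<in> ctypes L x"
    unfolding ctypes_def using v by blast+
  ultimately have ab: "i (ctype x {}) \<in> C" "i (ctype x {v}) \<in> C" "i (ctype x {}) \<noteq> i (ctype x {v})"
    unfolding C_def using inj_onD[OF i(1)] by blast+
  have types: "ctype x (E \<A>) \<in> ctypes L x" if "\<A> \<in> Pow C - {{}}" for \<A>
    unfolding ctypes_def using E_sub[OF that] by blast
  show False
  proof (rule not_inj_on_nonempty_subsets[OF _ _ ab])
    show "inj_on (\<lambda>\<A>. i (ctype x (E \<A>))) (Pow C - {{}})"
    proof (rule inj_onI)
      fix \<A> \<B> assume A: "\<A> \<in> Pow C - {{}}" and B: "\<B> \<in> Pow C - {{}}"
        and "i (ctype x (E \<A>)) = i (ctype x (E \<B>))"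
      then have "ctype x (E \<A>) = ctype x (E \<B>)"
        using i(1) types by (meson inj_onD)
      then show "\<A> = \<B>"
        using mono[OF A B] mono[OF B A] by simp
    qed
    show "(\<lambda>\<A>. i (ctype x (E \<A>))) ` (Pow C - {{}}) \<subseteq> C"
      using types unfolding C_def by blast
  qed
qed

text \<open>
  Take a mobile vertex and an infinite set of channels with the least number \<open>c\<close> of types. Below it
  all sibling classes have size at most \<open>c\<close> by the diagonal argument, so \<open>rigid_extension\<close>
  applies there, and it gives at least \<open>2\<^sup>m\<close> types.
\<close>

lemma sib_le_ctypes:
  fixes M :: "'b set"
  assumes room: "\<And>x L. mobile x \<Longrightarrow> infinite L \<Longrightarrow> |M| \<le>o |desc x \<inter> chan L|" and M: "M \<noteq> {}"
    and few: "\<And>x. mobile x \<Longrightarrow> |sib x| \<le>o |Pow M|"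
    and x: "mobile x" and L: "infinite L"
  shows "|sib x| \<le>o |ctypes L x|"
proof -
  have "|Pow M| \<le>o |ctypes L x|"
  proof (rule ccontr)
    assume "\<not> |Pow M| \<le>o |ctypes L x|"
    define K where "K = {(L, x). mobile x \<and> infinite L \<and> \<not> |Pow M| \<le>o |ctypes L x|}"
    let ?R = "(\<lambda>(L, x). |ctypes L x| ) ` K"
    have "(L, x) \<in> K"
      using \<open>\<not> |Pow M| \<le>o |ctypes L x|\<close> x L by (simp add: K_def)
    then have "?R \<noteq> {}"
      by blast
    moreover have "\<forall>r\<in>?R. Card_order r"
      by (auto simp: card_of_Card_order)
    ultimately obtain r where "r \<in> ?R" and r: "\<forall>r'\<in>?R. r \<le>o r'"
      using exists_minim_Card_order[of ?R] by blast
    then obtain L0 x0 where "(L0, x0) \<in> K" and r0: "r = |ctypes L0 x0|"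
      by auto
    then have x0: "mobile x0" "infinite L0" "\<not> |Pow M| \<le>o |ctypes L0 x0|"
      by (simp_all add: K_def)
    \<comment> \<open>Minimal among the counterexamples, the number is minimal among all pairs,
      because any other pair has at least \<open>|Pow M|\<close> types, which is more.\<close>
    have least: "|ctypes L0 x0| \<le>o |ctypes L' z|" if "mobile z" "infinite L'" for z L'
    proof (cases "|Pow M| \<le>o |ctypes L' z|")
      case True
      have "|ctypes L0 x0| \<le>o |Pow M|"
        using ordLeq_total[OF card_of_Well_order card_of_Well_order] x0(3) by blast
      then show ?thesis
        using True by (rule ordLeq_transitive)
    next
      case False
      then have "(L', z) \<in> K"
        using that by (simp add: K_def)
      then show ?thesis
        using bspec[OF r imageI, of "(L', z)"] unfolding r0 by simp
    qed
    have room': "|sib z| \<le>o |ctypes L' z|"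
      if z: "z \<in> desc x0 - {x0}" "mobile z" and "L' \<subseteq> L0" "infinite L'" for z L'
    proof -
      have "desc x0 \<inter> chan L0 \<noteq> {}"
        using room[OF x0(1,2)] M card_of_empty3 by metis
      \<comment> \<open>The diagonal argument is applied with the same channels \<open>L0\<close> at
        \<open>x0\<close> and \<open>z\<close>; minimality supplies its comparison of types.\<close>
      then have "\<not> |ctypes L0 x0| \<le>o |sib z|"
        using ctypes_diagonal[of z x0 L0] z least[OF z(2) x0(2)] by blast
      then have "|sib z| \<le>o |ctypes L0 x0|"
        using ordLeq_total[OF card_of_Well_order card_of_Well_order] by blast
      then show ?thesis
        using least[OF z(2) that(4)] by (rule ordLeq_transitive)
    qed
    have "x0 \<in> V"
      using x0(1) by (simp add: mobile_def)
    obtain L1 :: "nat set" and E where "L1 \<subseteq> L0" and L1: "infinite L1"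
      and E: "\<And>A. A \<subseteq> desc x0 \<inter> chan L1 \<Longrightarrow> E A \<subseteq> desc x0 \<inter> chan L0"
      "\<And>A B g. \<lbrakk>A \<subseteq> desc x0 \<inter> chan L1; B \<subseteq> desc x0 \<inter> chan L1; g \<in> G; g x0 = x0; g ` E A = E B\<rbrakk>
        \<Longrightarrow> A = B \<and> (\<forall>v \<in> desc x0. g v = v)"
      by (rule rigid_extension[OF \<open>x0 \<in> V\<close> x0(2)]) ((rule room'; assumption), (rule that; assumption))
    \<comment> \<open>Every subset of the free part of the branch gets its own type, so there are at
      least \<open>2^|M|\<close> types after all, against the choice of \<open>x0\<close>.\<close>
    have "inj_on (\<lambda>A. ctype x0 (E A)) (Pow (desc x0 \<inter> chan L1))"
    proof (rule inj_onI)
      fix A B assume AB: "A \<in> Pow (desc x0 \<inter> chan L1)" "B \<in> Pow (desc x0 \<inter> chan L1)"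
        and "ctype x0 (E A) = ctype x0 (E B)"
      then obtain g where "g \<in> G" "g x0 = x0" "g ` E A = E B"
        using ctype_eqD by metis
      then show "A = B"
        using E(2)[of A B g] AB by simp
    qed
    moreover have "(\<lambda>A. ctype x0 (E A)) ` Pow (desc x0 \<inter> chan L1) \<subseteq> ctypes L0 x0"
      using E(1) unfolding ctypes_def by blast
    ultimately have "|Pow (desc x0 \<inter> chan L1)| \<le>o |ctypes L0 x0|"
      using card_of_ordLeq by blast
    moreover have "|Pow M| \<le>o |Pow (desc x0 \<inter> chan L1)|"
      using room[OF x0(1) L1] by (rule card_of_Pow_mono)
    ultimately show False
      using x0(3) ordLeq_transitive[of "|Pow M|"] by blast
  qed
  then show ?thesis
    by (rule ordLeq_transitive[OF few[OF x]])
qed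

end

section \<open>Channels of full size below mobile vertices\<close>

text \<open>An infinite set is equinumerous with its product with the naturals; the second
  coordinate splits each infinite fibre into countably many parts of full size.\<close>

lemma split_fibres:
  fixes \<beta> :: "'a \<Rightarrow> 'b" and X :: "'a set"
  shows "\<exists>\<sigma> :: 'a \<Rightarrow> nat. \<forall>c n. infinite {x \<in> X. \<beta> x = c} \<longrightarrow>
    |{x \<in> X. \<beta> x = c}| \<le>o |{x \<in> X. \<beta> x = c \<and> \<sigma> x = n}|"
proof -
  let ?F = "\<lambda>c. {x \<in> X. \<beta> x = c}"
  have "\<exists>f. infinite (?F c) \<longrightarrow> bij_betw f (?F c) (?F c \<times> (UNIV :: nat set))" for c
  proof (cases "infinite (?F c)")
    case True
    then have "|UNIV :: nat set| \<le>o |?F c|"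
      by (rule infinite_iff_card_of_nat[THEN iffD1])
    then have "|?F c| =o |?F c \<times> (UNIV :: nat set)|"
      by (rule card_of_Times_infinite_simps(2)[OF True UNIV_not_empty])
    then obtain f where "bij_betw f (?F c) (?F c \<times> (UNIV :: nat set))"
      using card_of_ordIso by blast
    then show ?thesis
      by blast
  qed blast
  then have "\<forall>c. \<exists>f. infinite (?F c) \<longrightarrow> bij_betw f (?F c) (?F c \<times> (UNIV :: nat set))"
    by blast
  then obtain f where f: "\<And>c. infinite (?F c) \<Longrightarrow> bij_betw (f c) (?F c) (?F c \<times> (UNIV :: nat set))"
    unfolding choice_iff by blast
  have "|?F c| \<le>o |{x \<in> X. \<beta> x = c \<and> snd (f (\<beta> x) x) = n}|" if "infinite (?F c)" for c n
  proof (rule card_of_ordLeqI)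
    let ?i = "inv_into (?F c) (f c)"
    have b: "bij_betw ?i (?F c \<times> UNIV) (?F c)"
      using bij_betw_inv_into[OF f[OF that]] .
    show "inj_on (\<lambda>x. ?i (x, n)) (?F c)"
      using bij_betw_imp_inj_on[OF b] by (auto simp: inj_on_def)
    fix x assume x: "x \<in> ?F c"
    have "?i (x, n) \<in> ?F c"
      using bij_betwE[OF b] x by blast
    moreover have "f c (?i (x, n)) = (x, n)"
      using bij_betw_inv_into_right[OF f[OF that]] x by blast
    ultimately show "?i (x, n) \<in> {x \<in> X. \<beta> x = c \<and> snd (f (\<beta> x) x) = n}"
      unfolding mem_Collect_eq by (metis snd_conv)
  qed
  then show ?thesis
    by (intro exI[of _ "\<lambda>x. snd (f (\<beta> x) x)"]) blast
qed

locale rayed_action = tree_action V w par lev G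
  for V :: "'v set" and w par lev G +
  assumes root_core: "w \<in> core"
    and mobile_infinite: "mobile x \<Longrightarrow> infinite (desc x)"
begin

lemma core_act:
  assumes "g \<in> G" "v \<in> core"
  shows "g v \<in> core"
proof -
  obtain s where s: "s 0 = v" "\<And>n. s n \<in> V \<and> s (Suc n) \<noteq> w \<and> par (s (Suc n)) = s n"
    using assms by (auto simp: core_def)
  have sV: "s n \<in> V" for n
    using s(2) by blast
  have "g (s (Suc n)) \<noteq> w" for n
    using s(2) sV act_root[OF assms(1)] act_inj[OF assms(1)] root_in by (metis inj_onD)
  moreover have "par (g (s (Suc n))) = g (s n)" for n
    using act_par[OF assms(1) sV] s(2) by metis
  ultimately have "g (s n) \<in> V \<and> g (s (Suc n)) \<noteq> w \<and> par (g (s (Suc n))) = g (s n)" for n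
    using act_in[OF assms(1) sV] by blast
  then show ?thesis
    unfolding core_def using s(1) by (intro CollectI exI[of _ "\<lambda>n. g (s n)"]) auto
qed

lemma core_act_iff: "g \<in> G \<Longrightarrow> v \<in> V \<Longrightarrow> g v \<in> core \<longleftrightarrow> v \<in> core"
  using core_act[of g v] core_act[OF inv_in, of g "g v"] by (auto simp: act_left_inv)

section \<open>Anchors and the rigid blocks hanging below them\<close>

definition anchors :: "'v set" where
  "anchors = core \<union> {x. mobile x}"

lemma anchors_in: "a \<in> anchors \<Longrightarrow> a \<in> V"
  using core_in by (auto simp: anchors_def mobile_def)

lemma anchors_act_iff: "g \<in> G \<Longrightarrow> v \<in> V \<Longrightarrow> g v \<in> anchors \<longleftrightarrow> v \<in> anchors"
  using core_act_iff mobile_act_iff by (simp add: anchors_def)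

definition anchor :: "'v \<Rightarrow> 'v" where
  "anchor v = (par ^^ (LEAST k. (par ^^ k) v \<in> anchors)) v"

lemma anchor_ex: "v \<in> V \<Longrightarrow> \<exists>k. (par ^^ k) v \<in> anchors"
  using desc_root root_core by (force simp: desc_def anchors_def)

lemma anchor_in: "v \<in> V \<Longrightarrow> anchor v \<in> anchors"
  unfolding anchor_def using LeastI_ex[OF anchor_ex] .

lemma desc_anchor: "v \<in> V \<Longrightarrow> v \<in> desc (anchor v)"
  unfolding desc_def anchor_def by blast

lemma anchor_self: "v \<in> anchors \<Longrightarrow> anchor v = v"
  by (simp add: anchor_def Least_eq_0)

lemma anchor_par:
  assumes "v \<in> V" "v \<notin> anchors"
  shows "anchor v = anchor (par v)"
proof -
  obtain k where "(par ^^ k) v \<in> anchors"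
    using anchor_ex[OF assms(1)] by blast
  then have "(LEAST k. (par ^^ k) v \<in> anchors) = Suc (LEAST k. (par ^^ Suc k) v \<in> anchors)"
    by (rule Least_Suc) (use assms(2) in simp)
  then show ?thesis
    by (simp add: anchor_def funpow_swap1)
qed

lemma anchor_act: "g \<in> G \<Longrightarrow> v \<in> V \<Longrightarrow> anchor (g v) = g (anchor v)"
  using anchors_act_iff funpow_par_in by (simp add: anchor_def flip: act_funpow)

lemma not_root: "v \<notin> anchors \<Longrightarrow> v \<noteq> w"
  using root_core by (auto simp: anchors_def)

lemma anchor_desc:
  assumes "x \<in> anchors"
  shows "v \<in> desc x \<Longrightarrow> anchor v \<in> desc x"
proof (induction "lev v" arbitrary: v rule: less_induct)
  case less
  show ?case
  proof (cases "v \<in> anchors")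
    case False
    then have "v \<noteq> x" "v \<in> V"
      using less.prems assms desc_in by auto
    then have "lev v = Suc (lev (par v))" "par v \<in> desc x"
      using less.prems lev_Suc not_root[OF False] desc_par by auto
    then show ?thesis
      using less.hyps anchor_par[OF \<open>v \<in> V\<close> False] by simp
  qed (use less.prems anchor_self in simp)
qed

text \<open>On the way from \<open>anchor v\<close> down to \<open>v\<close> no vertex after the
  anchor is mobile, so once the anchor is fixed each next vertex has nowhere else to go.\<close>

lemma fixes_block:
  assumes "g \<in> G"
  shows "v \<in> V \<Longrightarrow> g (anchor v) = anchor v \<Longrightarrow> g v = v"
proof (induction "lev v" arbitrary: v rule: less_induct)
  case less
  show ?case
  proof (cases "v \<in> anchors")
    case False
    then have "lev v = Suc (lev (par v))" "par v \<in> V" "anchor (par v) = anchor v"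
      using less.prems lev_Suc not_root par_in anchor_par by auto
    then have "g (par v) = par v"
      using less.hyps less.prems by simp
    then have "g v \<in> sib v"
      using assms act_par[OF assms less.prems(1)] by (auto simp: sib_def orb_def)
    then show ?thesis
      using False less.prems(1) by (auto simp: anchors_def mobile_def)
  qed (use less.prems anchor_self in simp)
qed

definition block :: "'v \<Rightarrow> 'v set" where
  "block a = {v \<in> V - core. anchor v = a}"

text \<open>Orbits are split instead of vertices, which makes the resulting channels invariant under
  \<open>G\<close>. They are grouped by the orbit of their anchors.\<close>

definition orbit_split :: "'v set \<Rightarrow> nat" where
  "orbit_split = (SOME \<sigma>. \<forall>c n. infinite {x \<in> orb ` (V - core). anchor ` x = c} \<longrightarrow>
    |{x \<in> orb ` (V - core). anchor ` x = c}| \<le>o |{x \<in> orb ` (V - core). anchor ` x = c \<and> \<sigma> x = n}| )"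

lemma orbit_split: "infinite {x \<in> orb ` (V - core). anchor ` x = c} \<Longrightarrow>
  |{x \<in> orb ` (V - core). anchor ` x = c}|
    \<le>o |{x \<in> orb ` (V - core). anchor ` x = c \<and> orbit_split x = n}|"
  using someI_ex[OF split_fibres[of "orb ` (V - core)" "\<lambda>x. anchor ` x"], folded orbit_split_def]
  by simp

lemma anchor_orb: "v \<in> V \<Longrightarrow> anchor ` orb v = orb (anchor v)"
proof (intro equalityI subsetI)
  fix y assume v: "v \<in> V" and "y \<in> orb (anchor v)"
  then obtain g where g: "g \<in> G" "y = g (anchor v)"
    by (auto simp: orb_def)
  then show "y \<in> anchor ` orb v"
    using anchor_act[OF g(1) v] unfolding orb_def by (metis (mono_tags, lifting) CollectI imageI)
qed (auto simp: orb_def anchor_act)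

text \<open>Together with \<open>inj_on_orb_block\<close> this identifies \<open>block a\<close>
  with a fibre of the map taking an orbit to the orbit of its anchors, so splitting fibres splits
  blocks.\<close>

lemma orb_block: "a \<in> V \<Longrightarrow> orb ` block a = {x \<in> orb ` (V - core). anchor ` x = orb a}"
proof (intro equalityI subsetI)
  fix x assume "x \<in> orb ` block a"
  then obtain v where "v \<in> V - core" "anchor v = a" "x = orb v"
    by (auto simp: block_def)
  then show "x \<in> {x \<in> orb ` (V - core). anchor ` x = orb a}"
    using anchor_orb[of v] by simp
next
  fix x assume a: "a \<in> V" and "x \<in> {x \<in> orb ` (V - core). anchor ` x = orb a}"
  then obtain u where u: "u \<in> V - core" "x = orb u" "orb (anchor u) = orb a"
    by (auto simp: anchor_orb)
  have "a \<in> orb (anchor u)"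
    using orb_refl[of a] u(3) by simp
  then obtain g where g: "g \<in> G" "a = g (anchor u)"
    by (auto simp: orb_def)
  then have block: "g u \<in> block a"
    using u(1) act_in[OF g(1)] core_act_iff[OF g(1)] anchor_act[OF g(1)] by (simp add: block_def)
  have "orb (g u) = x"
    using u orb_act[OF g(1)] by simp
  with block show "x \<in> orb ` block a"
    by blast
qed

text \<open>An element of \<open>G\<close> taking one vertex of the block to another fixes their
  common anchor, hence both vertices by \<open>fixes_block\<close>.\<close>

lemma inj_on_orb_block: "inj_on orb (block a)"
proof (rule inj_onI)
  fix u v assume uv: "u \<in> block a" "v \<in> block a" "orb u = orb v"
  then have "u \<in> orb v"
    using orb_refl[of u] by simp
  then obtain g where g: "g \<in> G" "u = g v"
    by (auto simp: orb_def)
  then have "g (anchor v) = anchor v"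
    using uv anchor_act[OF g(1), of v] by (simp add: block_def)
  then show "u = v"
    using fixes_block[OF g(1), of v] uv g by (simp add: block_def)
qed

lemma block_split:
  assumes "a \<in> V" "infinite (block a)"
  shows "|block a| \<le>o |{v \<in> block a. orbit_split (orb v) = n}|"
proof -
  have "infinite (orb ` block a)"
    using assms(2) finite_imageD inj_on_orb_block by blast
  then have *: "|orb ` block a| \<le>o |{x \<in> orb ` block a. orbit_split x = n}|"
    using orbit_split[of "orb a" n] unfolding orb_block[OF assms(1)] by simp
  have eq: "{x \<in> orb ` block a. orbit_split x = n} = orb ` {v \<in> block a. orbit_split (orb v) = n}"
    by blast
  have "|orb ` block a| \<le>o |{v \<in> block a. orbit_split (orb v) = n}|"
    using ordLeq_transitive[OF *[unfolded eq] card_of_image] .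
  moreover have "|block a| \<le>o |orb ` block a|"
    by (rule card_of_ordLeqI[OF inj_on_orb_block]) simp
  ultimately show ?thesis
    using ordLeq_transitive by blast
qed

text \<open>Core vertices on even levels and on level 1 are withheld, so that a pattern there can
  identify the root.\<close>

definition free :: "'v set" where
  "free = {v \<in> V. v \<in> core \<longrightarrow> odd (lev v) \<and> 3 \<le> lev v}"

text \<open>On the core, the levels 3, 5, 7 and so on become the channels 0, 1, 2 and so on.\<close>

definition channel :: "'v \<Rightarrow> nat" where
  "channel v = (if v \<in> core then (lev v - 3) div 2 else orbit_split (orb v))"

sublocale channels V w par lev G free channel
proof
  show "free \<subseteq> V"
    by (auto simp: free_def)
  show "g v \<in> free" if "g \<in> G" "v \<in> free" for g v
    using that core_act_iff[OF that(1)] act_lev[OF that(1)] act_in[OF that(1)] by (simp add: free_def)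
  show "channel (g v) = channel v" if "g \<in> G" "v \<in> free" for g v
    using that(2) core_act_iff[OF that(1)] act_lev[OF that(1)] orb_act[OF that(1)]
    by (simp add: free_def channel_def)
qed

text \<open>If all blocks of mobile vertices below \<open>a\<close> were finite, each of their
  branches, being infinite, would contain another mobile vertex strictly below its top. Descending
  towards such vertices forever gives a ray, which puts \<open>a\<close> in the core.\<close>

lemma infinite_block_below:
  assumes "mobile a" "a \<notin> core"
  shows "\<exists>b \<in> desc a. mobile b \<and> infinite (block b)"
proof (rule ccontr)
  assume none: "\<not> ?thesis"
  define Y where "Y = {v \<in> desc a. \<exists>b \<in> desc v. mobile b}"
  have not_core: "v \<notin> core" if "v \<in> desc a" for v
    using that core_desc assms(2) by blast
  have "a \<in> core"
  proof (rule core_coinduct)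
    show "a \<in> Y" "Y \<subseteq> V"
      using assms(1) desc_refl desc_subset by (auto simp: Y_def mobile_def)
    fix v assume "v \<in> Y"
    then obtain b where v: "v \<in> desc a" and b: "b \<in> desc v" "mobile b"
      by (auto simp: Y_def)
    have "\<exists>b' \<in> desc v. mobile b' \<and> b' \<noteq> v"
    proof (cases "b = v")
      case True
      then have "infinite (desc v - block v)"
        using none v b(2) mobile_infinite by (metis Diff_infinite_finite)
      then obtain u where u: "u \<in> desc v" "u \<notin> block v"
        by (metis Diff_iff ex_in_conv finite.emptyI)
      have "v \<in> anchors"
        using True b(2) by (simp add: anchors_def)
      then have au: "anchor u \<in> desc v"
        using anchor_desc u(1) by blast
      moreover have "anchor u \<noteq> v"
        using u not_core[OF desc_trans[OF u(1) v]] desc_in by (auto simp: block_def)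
      moreover have "mobile (anchor u)"
        using anchor_in[OF desc_in[OF u(1)]] not_core[OF desc_trans[OF au v]] by (auto simp: anchors_def)
      ultimately show ?thesis by blast
    qed (use b in blast)
    then obtain b' where b': "b' \<in> desc v" "mobile b'" "b' \<noteq> v"
      by blast
    then obtain c where c: "c \<in> V" "c \<noteq> w" "par c = v" "b' \<in> desc c"
      using desc_child by metis
    then have "c \<in> Y"
      using b' v desc_step by (auto simp: Y_def)
    then show "\<exists>c\<in>Y. c \<noteq> w \<and> par c = v"
      using c by blast
  qed
  then show False
    using assms(2) by simp
qed

lemma block_subset_desc: "block a \<subseteq> desc a"
  using desc_anchor by (auto simp: block_def)

lemma block_chan: "n \<in> L \<Longrightarrow> {v \<in> block a. orbit_split (orb v) = n} \<subseteq> desc a \<inter> chan L"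
proof -
  assume "n \<in> L"
  moreover have "block a \<subseteq> free"
    by (auto simp: block_def free_def)
  ultimately show ?thesis
    using block_subset_desc unfolding chan_def by (auto simp: block_def channel_def)
qed

lemma infinite_desc_chan:
  assumes "a \<in> anchors" "infinite L"
  shows "infinite (desc a \<inter> chan L)"
proof (cases "a \<in> core")
  case True
  \<comment> \<open>The core part of the branch reaches every level from \<open>lev a\<close> on,
    and level \<open>2 * n + 3\<close> is channel \<open>n\<close>. Taking \<open>n\<close> at least
    \<open>lev a\<close> ensures that this level is reached.\<close>
  have "(\<lambda>n. 2 * n + 3) ` (L - {..<lev a}) \<subseteq> lev ` (desc a \<inter> chan L)"
  proof
    fix k assume "k \<in> (\<lambda>n. 2 * n + 3) ` (L - {..<lev a})"
    then obtain n where n: "k = 2 * n + 3" "n \<in> L" "n \<notin> {..<lev a}"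
      by blast
    then obtain u where u: "u \<in> core \<inter> desc a" "lev u = k"
      using core_level[OF True, of "k - lev a"] n(3) by auto
    then have "u \<in> free"
      using n(1) core_in by (auto simp: free_def)
    then have "u \<in> desc a \<inter> chan L"
      using u n unfolding chan_def by (auto simp: channel_def)
    then show "k \<in> lev ` (desc a \<inter> chan L)"
      using u by blast
  qed
  moreover have "infinite ((\<lambda>n :: nat. 2 * n + 3) ` (L - {..<lev a}))"
    using assms(2) by (subst finite_image_iff) (auto simp: inj_on_def Diff_infinite_finite)
  ultimately show ?thesis
    using finite_subset by blast
next
  case False
  then have "mobile a"
    using assms(1) by (simp add: anchors_def)
  then obtain b where b: "b \<in> desc a" "mobile b" "infinite (block b)"
    using infinite_block_below False by blast
  obtain n where n: "n \<in> L"
    using assms(2) by (metis ex_in_conv finite.emptyI)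
  have "infinite {v \<in> block b. orbit_split (orb v) = n}"
    using block_split[of b n] b(3) card_of_ordLeq_infinite desc_in[OF b(1)] by blast
  moreover have "{v \<in> block b. orbit_split (orb v) = n} \<subseteq> desc a \<inter> chan L"
    using block_chan[OF n, of b] desc_trans[OF _ b(1)] by blast
  ultimately show ?thesis
    using finite_subset by blast
qed

text \<open>The branch consists of anchors and blocks. Each anchor is an ancestor of some vertex of
  the infinite set \<open>?Z\<close>, which has countably many ancestors per vertex, and each
  infinite block is no larger than its part in a single channel of \<open>L\<close>.\<close>

lemma desc_le_chan:
  assumes x: "x \<in> anchors" and L: "infinite L"
  shows "|desc x| \<le>o |desc x \<inter> chan L|"
proof -
  let ?Z = "desc x \<inter> chan L" and ?A = "anchors \<inter> desc x"
  have Z: "infinite ?Z"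
    using infinite_desc_chan[OF assms] .
  have "?A \<subseteq> (\<lambda>(z, k). (par ^^ k) z) ` (?Z \<times> UNIV)"
  proof
    fix a assume a: "a \<in> ?A"
    then have "desc a \<inter> chan L \<noteq> {}"
      using infinite_desc_chan[OF _ L, of a] by (metis IntD1 finite.emptyI)
    then obtain z where z: "z \<in> desc a" "z \<in> chan L"
      by blast
    then obtain k where "(par ^^ k) z = a"
      by (auto simp: desc_def)
    moreover have "z \<in> ?Z"
      using z a desc_trans by blast
    ultimately show "a \<in> (\<lambda>(z, k). (par ^^ k) z) ` (?Z \<times> UNIV)"
      by force
  qed
  then have "|?A| \<le>o |?Z \<times> (UNIV :: nat set)|"
    by (meson card_of_image card_of_mono1 ordLeq_transitive)
  moreover have "|?Z \<times> (UNIV :: nat set)| =o |?Z|"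
    by (rule card_of_Times_infinite_simps(1)[OF Z UNIV_not_empty infinite_iff_card_of_nat[THEN iffD1, OF Z]])
  ultimately have A: "|?A| \<le>o |?Z|"
    by (rule ordLeq_ordIso_trans)
  have "|block a| \<le>o |?Z|" if a: "a \<in> ?A" for a
  proof (cases "finite (block a)")
    case True
    then have "\<not> |?Z| \<le>o |block a|"
      using card_of_ordLeq_infinite[OF _ Z] by blast
    then show ?thesis
      using ordLeq_total[OF card_of_Well_order card_of_Well_order] by blast
  next
    case False
    obtain n where n: "n \<in> L"
      using L by (metis ex_in_conv finite.emptyI)
    have "{v \<in> block a. orbit_split (orb v) = n} \<subseteq> ?Z"
      using block_chan[OF n, of a] desc_trans a by blast
    then have "|{v \<in> block a. orbit_split (orb v) = n}| \<le>o |?Z|"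
      by (rule card_of_mono1)
    moreover have "a \<in> V"
      using a anchors_in by blast
    ultimately show ?thesis
      using ordLeq_transitive[OF block_split[OF _ False, of n]] by blast
  qed
  then have "|\<Union>a \<in> ?A. block a| \<le>o |?Z|"
    using card_of_UNION_ordLeq_infinite[OF Z A] by blast
  then have "|?A \<union> (\<Union>a \<in> ?A. block a)| \<le>o |?Z|"
    using Z A by (intro card_of_Un_ordLeq_infinite_Field[OF _ _ _ card_of_Card_order])
      (simp_all add: Field_card_of)
  moreover have "desc x \<subseteq> ?A \<union> (\<Union>a \<in> ?A. block a)"
  proof
    fix v assume v: "v \<in> desc x"
    then have "anchor v \<in> ?A"
      using anchor_in anchor_desc[OF x] desc_in by blast
    moreover have "v \<in> anchors \<or> v \<in> block (anchor v)"
      using desc_in[OF v] by (auto simp: block_def anchors_def)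
    ultimately show "v \<in> ?A \<union> (\<Union>a \<in> ?A. block a)"
      using v by blast
  qed
  then have "|desc x| \<le>o |?A \<union> (\<Union>a \<in> ?A. block a)|"
    by (rule card_of_mono1)
  ultimately show ?thesis
    using ordLeq_transitive by blast
qed

end

section \<open>Trees as rooted trees\<close>

lemma relpowp_successively:
  "successively R p \<Longrightarrow> p \<noteq> [] \<Longrightarrow> (R ^^ (length p - 1)) (hd p) (last p)"
proof (induction p)
  case (Cons x p)
  show ?case
  proof (cases p)
    case (Cons y q)
    then have "R x y" "(R ^^ (length p - 1)) y (last p)"
      using Cons.IH Cons.prems by auto
    then have "(R ^^ Suc (length p - 1)) x (last p)"
      by (rule relpowp_Suc_I2)
    then show ?thesis
      using Cons by simp
  qed simp
qed simp

locale tree_with_root =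
  fixes T :: "'v graph" and w :: 'v
  assumes tree: "tree T" and root: "w \<in> verts T"
begin

abbreviation "V \<equiv> verts T"

lemma adjD: "adj T u v \<Longrightarrow> u \<in> V \<and> v \<in> V \<and> u \<noteq> v \<and> adj T v u"
  using tree unfolding tree_def simple_graph_def by blast

definition lev :: "'v \<Rightarrow> nat" where
  "lev v = (LEAST n. (adj T ^^ n) w v)"

lemma relpowp_lev:
  assumes "v \<in> V"
  shows "(adj T ^^ lev v) w v"
proof -
  have "connected_graph T"
    using tree by (simp add: tree_def)
  then obtain p where "is_path T p" "hd p = w" "last p = v"
    using root assms unfolding connected_graph_def by blast
  then have "(adj T ^^ (length p - 1)) w v"
    using relpowp_successively unfolding is_path_def by metis
  then show ?thesis
    unfolding lev_def by (rule LeastI)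
qed

lemma lev_le: "(adj T ^^ n) w v \<Longrightarrow> lev v \<le> n"
  unfolding lev_def by (rule Least_le)

lemma lev_adj: "adj T u v \<Longrightarrow> lev v \<le> Suc (lev u)"
  using lev_le relpowp_Suc_I relpowp_lev adjD by metis

lemma lev_root: "lev w = 0"
  using lev_le[of 0 w] by simp

lemma lev_0: "v \<in> V \<Longrightarrow> lev v = 0 \<Longrightarrow> v = w"
  using relpowp_lev[of v] by simp

lemma lower_neighbour:
  assumes "v \<in> V" "v \<noteq> w"
  shows "\<exists>u. adj T u v \<and> lev v = Suc (lev u)"
proof -
  obtain n where n: "lev v = Suc n"
    using lev_0 assms by (cases "lev v") auto
  then have "(adj T ^^ Suc n) w v"
    using relpowp_lev[OF assms(1)] by simp
  then obtain u where u: "(adj T ^^ n) w u" "adj T u v"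
    by (rule relpowp_Suc_E)
  then show ?thesis
    using lev_le[OF u(1)] lev_adj[OF u(2)] n by auto
qed

text \<open>A source of cycles: closing the path by an edge between its ends, or by a common
  neighbour one level further out, would contradict acyclicity. Passing to lower neighbours of both
  ends reduces the level until they meet; length 3 is what a cycle requires.\<close>

lemma low_path:
  "u \<in> V \<Longrightarrow> u' \<in> V \<Longrightarrow> u \<noteq> u' \<Longrightarrow> lev u = n \<Longrightarrow> lev u' = n \<Longrightarrow>
    \<exists>p. is_path T p \<and> hd p = u \<and> last p = u' \<and> 3 \<le> length p \<and> (\<forall>x \<in> set p. lev x \<le> n)"
proof (induction n arbitrary: u u')
  case 0
  then show ?case using lev_0 by metis
next
  case (Suc n)
  have "u \<noteq> w" "u' \<noteq> w"
    using Suc.prems lev_root by auto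
  then obtain q q' where q: "adj T q u" "lev q = n" "adj T q' u'" "lev q' = n"
    using lower_neighbour Suc.prems by (metis Suc_inject)
  have qV: "q \<in> V" "q' \<in> V" "adj T u q"
    using q adjD by auto
  show ?case
  proof (cases "q = q'")
    case True
    then have "is_path T [u, q, u']"
      using Suc.prems q qV by (auto simp: is_path_def)
    then show ?thesis
      using Suc.prems q by (intro exI[of _ "[u, q, u']"]) auto
  next
    case False
    then obtain p where p: "is_path T p" "hd p = q" "last p = q'" "\<forall>x \<in> set p. lev x \<le> n"
      using Suc.IH[OF qV(1,2)] q by blast
    have "u \<notin> set p" "u' \<notin> set p"
      using p(4) Suc.prems by auto
    then have "is_path T (u # p @ [u'])"
      using p q qV Suc.prems by (auto simp: is_path_def successively_append_iff successively_Cons)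
    moreover have "p \<noteq> []"
      using p(1) by (simp add: is_path_def)
    ultimately show ?thesis
      using p(4) Suc.prems by (intro exI[of _ "u # p @ [u']"]) (auto simp: Suc_le_eq)
  qed
qed

lemma no_cycle: "\<not> is_cycle T p"
  using tree by (simp add: tree_def)

lemma adj_lev_neq: "adj T u v \<Longrightarrow> lev u \<noteq> lev v"
proof
  assume uv: "adj T u v" "lev u = lev v"
  then obtain p where "is_path T p" "hd p = u" "last p = v" "3 \<le> length p"
    using low_path[of u v "lev v"] adjD by blast
  then have "is_cycle T p"
    using uv adjD by (simp add: is_cycle_def)
  then show False
    using no_cycle by blast
qed

lemma lower_neighbour_unique:
  assumes "adj T u v" "adj T u' v" "lev v = Suc (lev u)" "lev v = Suc (lev u')"
  shows "u = u'"
proof (rule ccontr)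
  assume "u \<noteq> u'"
  then obtain p where p: "is_path T p" "hd p = u" "last p = u'" "3 \<le> length p" "\<forall>x \<in> set p. lev x \<le> lev u"
    using low_path[of u u' "lev u"] adjD assms by auto
  then have "v \<notin> set p"
    using assms(3) by auto
  moreover have "v \<in> V" "adj T v u" "p \<noteq> []"
    using assms(1) adjD p(4) by auto
  ultimately have "is_cycle T (p @ [v])"
    using p assms(2) by (auto simp: is_cycle_def is_path_def successively_append_iff)
  then show False
    using no_cycle by blast
qed

definition par :: "'v \<Rightarrow> 'v" where
  "par v = (if v = w then w else SOME u. adj T u v \<and> lev v = Suc (lev u))"

lemma par:
  assumes "v \<in> V" "v \<noteq> w"
  shows "adj T (par v) v" "lev v = Suc (lev (par v))"
  using someI_ex[OF lower_neighbour[OF assms]] assms(2) unfolding par_def by auto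

lemma par_eqI: "adj T u v \<Longrightarrow> lev v = Suc (lev u) \<Longrightarrow> par v = u"
  using par[of v] lower_neighbour_unique[of "par v" v u] adjD[of u v] lev_root by (cases "v = w") auto

lemma adj_iff: "adj T u v \<longleftrightarrow> u \<in> V \<and> v \<in> V \<and> (v \<noteq> w \<and> par v = u \<or> u \<noteq> w \<and> par u = v)"
proof
  assume uv: "adj T u v"
  then have vu: "adj T v u"
    using adjD by blast
  have "lev v = Suc (lev u) \<or> lev u = Suc (lev v)"
    using lev_adj[OF uv] lev_adj[OF vu] adj_lev_neq[OF uv] by linarith
  then show "u \<in> V \<and> v \<in> V \<and> (v \<noteq> w \<and> par v = u \<or> u \<noteq> w \<and> par u = v)"
    using par_eqI[OF uv] par_eqI[OF vu] adjD[OF uv] lev_root by auto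
next
  assume V: "u \<in> V \<and> v \<in> V \<and> (v \<noteq> w \<and> par v = u \<or> u \<noteq> w \<and> par u = v)"
  then have "adj T (par v) v \<and> par v = u \<or> adj T (par u) u \<and> par u = v"
    using par(1)[of u] par(1)[of v] by blast
  then show "adj T u v"
    using adjD[of v u] by auto
qed

sublocale rooted_tree V w par lev
proof
  show w: "w \<in> V" and pw: "par w = w" and "lev w = 0"
    using root lev_root by (simp_all add: par_def)
  show "lev v = Suc (lev (par v))" if "v \<in> V" "v \<noteq> w" for v
    using par(2)[OF that] .
  show "par v \<in> V" if "v \<in> V" for v
    using par(1)[OF that] adjD[of "par v" v] w pw by (cases "v = w") auto
qed

section \<open>The stabilizer of the root and the swapping of branches\<close>

definition root_aut :: "('v \<Rightarrow> 'v) set" where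
  "root_aut = {\<phi>. automorphism T \<phi> \<and> \<phi> w = w}"

lemma aut_in: "automorphism T \<phi> \<Longrightarrow> v \<in> V \<Longrightarrow> \<phi> v \<in> V"
  unfolding automorphism_def using bij_betwE by blast

lemma aut_inj: "automorphism T \<phi> \<Longrightarrow> inj_on \<phi> V"
  unfolding automorphism_def bij_betw_def by blast

lemma aut_adj: "automorphism T \<phi> \<Longrightarrow> adj T u v \<Longrightarrow> adj T (\<phi> u) (\<phi> v)"
  unfolding automorphism_def using adjD by blast

lemma aut_inv_left: "automorphism T \<phi> \<Longrightarrow> v \<in> V \<Longrightarrow> inv_into V \<phi> (\<phi> v) = v"
  using aut_inj by simp

lemma aut_relpowp: "automorphism T \<phi> \<Longrightarrow> (adj T ^^ n) u v \<Longrightarrow> (adj T ^^ n) (\<phi> u) (\<phi> v)"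
proof (induction n arbitrary: v)
  case (Suc n)
  from Suc.prems(2) obtain u' where u': "(adj T ^^ n) u u'" "adj T u' v"
    by (rule relpowp_Suc_E)
  show ?case
    using relpowp_Suc_I[OF Suc.IH[OF Suc.prems(1) u'(1)] aut_adj[OF Suc.prems(1) u'(2)]] .
qed simp

lemma root_aut_inv: "\<phi> \<in> root_aut \<Longrightarrow> inv_into V \<phi> \<in> root_aut"
  using automorphism_inv[of T \<phi>] aut_inv_left[of \<phi> w] root by (simp add: root_aut_def)

lemma root_aut_lev_le: "\<phi> \<in> root_aut \<Longrightarrow> v \<in> V \<Longrightarrow> lev (\<phi> v) \<le> lev v"
  using lev_le aut_relpowp[OF _ relpowp_lev] by (fastforce simp: root_aut_def)

lemma root_aut_lev:
  assumes "\<phi> \<in> root_aut" "v \<in> V"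
  shows "lev (\<phi> v) = lev v"
proof -
  have "automorphism T \<phi>"
    using assms(1) by (simp add: root_aut_def)
  then have "lev v \<le> lev (\<phi> v)"
    using root_aut_lev_le[OF root_aut_inv[OF assms(1)], of "\<phi> v"] aut_in aut_inv_left assms(2) by simp
  then show ?thesis
    using root_aut_lev_le[OF assms] by simp
qed

sublocale tree_action V w par lev root_aut
proof
  show "bij_betw g V V" if "g \<in> root_aut" for g
    using that by (simp add: root_aut_def automorphism_def)
  show "g (par v) = par (g v)" if g: "g \<in> root_aut" and v: "v \<in> V" for g v
  proof (cases "v = w")
    case False
    have "adj T (g (par v)) (g v)"
      using aut_adj par(1)[OF v False] g by (simp add: root_aut_def)
    moreover have "lev (g v) = Suc (lev (g (par v)))"
      using root_aut_lev[OF g] par(2)[OF v False] par_in v by simp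
    ultimately show ?thesis
      using par_eqI by simp
  qed (use g par_root in \<open>simp add: root_aut_def\<close>)
  show "id \<in> root_aut"
    by (simp add: root_aut_def automorphism_id)
  show "f \<circ> g \<in> root_aut" if "f \<in> root_aut" "g \<in> root_aut" for f g
    using that automorphism_comp[of T g f] by (simp add: root_aut_def)
  show "inv_into V g \<in> root_aut" if "g \<in> root_aut" for g
    using root_aut_inv[OF that] .
qed

lemma automorphismI:
  assumes bij: "bij_betw \<sigma> V V" and root: "\<sigma> w = w" and par: "\<And>v. v \<in> V \<Longrightarrow> par (\<sigma> v) = \<sigma> (par v)"
  shows "automorphism T \<sigma>"
proof -
  have inj: "\<sigma> u = \<sigma> v \<longleftrightarrow> u = v" if "u \<in> V" "v \<in> V" for u v
    using bij that by (auto simp: bij_betw_def inj_on_eq_iff)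
  have "\<sigma> v = w \<longleftrightarrow> v = w" if "v \<in> V" for v
    using inj[OF that root_in] root by simp
  then have "adj T (\<sigma> u) (\<sigma> v) \<longleftrightarrow> adj T u v" if "u \<in> V" "v \<in> V" for u v
    using that bij_betwE[OF bij] inj par_in by (simp add: adj_iff par)
  then show ?thesis
    using bij by (simp add: automorphism_def)
qed

text \<open>The branches at \<open>x\<close> and a sibling \<open>y\<close> are exchanged by
  \<open>g\<close> and its inverse, everything else staying put. Adjacency survives because
  \<open>x\<close> and \<open>y\<close> share their parent and their branches are disjoint.\<close>

lemma mobile_swap:
  assumes "mobile x"
  obtains \<sigma> y where "automorphism T \<sigma>" "\<sigma> x \<noteq> x" "x \<in> V" "y \<in> sib x" "moved T \<sigma> \<subseteq> desc x \<union> desc y"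
proof -
  obtain y where y: "y \<in> sib x" "y \<noteq> x" and x: "x \<in> V"
    using assms by (auto simp: mobile_def)
  obtain g where g: "g \<in> root_aut" "y = g x" and py: "par y = par x"
    using sibE[OF y(1)] .
  define k where "k = inv_into V g"
  have k: "k \<in> root_aut" "k y = x"
    using inv_in[OF g(1)] act_left_inv[OF g(1) x] g(2) by (simp_all add: k_def)
  have yV: "y \<in> V"
    using sib_in[OF x y(1)] .
  have kg: "k (g v) = v" "g (k v) = v" if "v \<in> V" for v
    using act_left_inv[OF g(1) that] act_right_inv[OF g(1) that] by (simp_all add: k_def)
  have gd: "g v \<in> desc y" if "v \<in> desc x" for v
    using act_desc[OF g(1) that] g(2) by simp
  have kd: "k v \<in> desc x" if "v \<in> desc y" for v
    using act_desc[OF k(1) that] k(2) by simp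
  have disj: "v \<notin> desc y" if "v \<in> desc x" for v
    using desc_same_level[OF that, of y] sib_lev[OF x y(1)] y(2) by auto
  have nw: "x \<noteq> w" "y \<noteq> w"
    using act_root[OF g(1)] act_root[OF k(1)] g(2) k(2) y(2) by auto
  have lp: "lev (par x) < lev x" "lev y = lev x"
    using lev_Suc[OF x nw(1)] sib_lev[OF x y(1)] by auto
  define \<sigma> where "\<sigma> v = (if v \<in> desc x then g v else if v \<in> desc y then k v else v)" for v
  have \<sigma>\<sigma>: "\<sigma> (\<sigma> v) = v" if "v \<in> V" for v
    using that gd kd disj kg by (auto simp: \<sigma>_def)
  have \<sigma>V: "\<sigma> v \<in> V" if "v \<in> V" for v
    using that act_in g(1) k(1) by (auto simp: \<sigma>_def)
  have out: "par x \<notin> desc x" "par x \<notin> desc y" "w \<notin> desc x" "w \<notin> desc y"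
    using desc_lev lp lev_root by fastforce+
  have "automorphism T \<sigma>"
  proof (rule automorphismI)
    show "bij_betw \<sigma> V V"
      using \<sigma>\<sigma> \<sigma>V by (intro bij_betw_byWitness[of _ \<sigma>]) auto
    show "\<sigma> w = w"
      using out by (simp add: \<sigma>_def)
    show "par (\<sigma> v) = \<sigma> (par v)" if v: "v \<in> V" for v
    proof -
      consider "v = x" | "v = y" | "v \<in> desc x" "v \<noteq> x" | "v \<in> desc y" "v \<noteq> y" | "v \<notin> desc x" "v \<notin> desc y"
        by blast
      then show ?thesis
      proof cases
        case 1
        then show ?thesis
          using out py desc_refl[OF x] g(2) by (simp add: \<sigma>_def)
      next
        case 2
        then show ?thesis
          using out py desc_refl[OF yV] disj[of y] k(2) by (auto simp: \<sigma>_def)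
      next
        case 3
        then show ?thesis
          using desc_par[OF 3] act_par[OF g(1) v] by (simp add: \<sigma>_def)
      next
        case 4
        then show ?thesis
          using desc_par[OF 4] act_par[OF k(1) v] disj by (auto simp: \<sigma>_def)
      next
        case 5
        then have "par v \<notin> desc x" "par v \<notin> desc y"
          using desc_step v by blast+
        then show ?thesis
          using 5 by (simp add: \<sigma>_def)
      qed
    qed
  qed
  moreover have "\<sigma> x \<noteq> x"
    using desc_refl[OF x] g(2) y(2) by (simp add: \<sigma>_def)
  moreover have "moved T \<sigma> \<subseteq> desc x \<union> desc y"
    by (auto simp: moved_def \<sigma>_def)
  ultimately show ?thesis
    using that x y(1) by blast
qed

text \<open>The swap moves only vertices of two branches of equal size, and the union of two such
  infinite sets is no larger than one of them.\<close>

lemma motion_le_desc: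
  assumes "motion T = Some m" "cinfinite m" "mobile x"
  shows "infinite (desc x)" "m \<le>o |desc x|"
proof -
  obtain \<sigma> y where \<sigma>: "automorphism T \<sigma>" "\<sigma> x \<noteq> x" and x: "x \<in> V" and y: "y \<in> sib x"
    and sub: "moved T \<sigma> \<subseteq> desc x \<union> desc y"
    using mobile_swap[OF assms(3)] .
  have "moved T \<sigma> \<noteq> {}"
    using \<sigma>(2) x by (auto simp: moved_def)
  then have "m \<le>o |moved T \<sigma>|"
    using motion_SomeD(2)[OF assms(1) \<sigma>(1)] by blast
  then have m: "m \<le>o |desc x \<union> desc y|"
    using card_of_mono1[OF sub] ordLeq_transitive by blast
  obtain g where g: "g \<in> root_aut" "y = g x"
    using sibE[OF y] .
  have "desc y = g ` desc x"
    using act_image_desc[OF g(1) subset_refl x] act_bij[OF g(1)] desc_subset g(2)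
    by (simp add: bij_betw_def Int_absorb1)
  then have yx: "|desc y| \<le>o |desc x|" and fin: "finite (desc x) \<Longrightarrow> finite (desc y)"
    by (simp_all add: card_of_image)
  obtain \<phi> where \<phi>: "m = |moved T \<phi>|"
    using motion_SomeD(1)[OF assms(1)] by blast
  then have "infinite (moved T \<phi>)"
    using assms(2) by (simp add: cinfinite_def Field_card_of)
  then have "infinite (desc x \<union> desc y)"
    using card_of_ordLeq_infinite m unfolding \<phi> by blast
  then show inf: "infinite (desc x)"
    using fin by blast
  have "|desc x \<union> desc y| \<le>o |desc x|"
    using inf yx by (intro card_of_Un_ordLeq_infinite_Field[OF _ _ _ card_of_Card_order])
      (simp_all add: Field_card_of card_of_mono1)
  then show "m \<le>o |desc x|"
    using m ordLeq_transitive by blast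
qed

lemma sib_le_degree: "mobile x \<Longrightarrow> |sib x| \<le>o degree T (par x)"
  unfolding degree_def
proof (rule card_of_mono1, rule subsetI)
  fix y assume x: "mobile x" and y: "y \<in> sib x"
  have V: "x \<in> V" "y \<in> V"
    using x y sib_in by (auto simp: mobile_def)
  obtain g where g: "g \<in> root_aut" "y = g x"
    using sibE[OF y] .
  have "x \<noteq> w"
    using x act_root by (auto simp: mobile_def sib_def orb_def)
  then have "y \<noteq> w"
    using g act_root[OF g(1)] inj_onD[OF act_inj[OF g(1)] _ V(1) root_in] by metis
  then show "y \<in> {u \<in> V. adj T (par x) u}"
    using par(1)[OF V(2)] V(2) y by (auto simp: sib_def)
qed

end

section \<open>Double rays\<close>

text \<open>Non-backtracking walks; in a tree these are exactly the rays.\<close>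

definition nb_ray :: "'v graph \<Rightarrow> (nat \<Rightarrow> 'v) \<Rightarrow> bool" where
  "nb_ray T \<rho> \<longleftrightarrow> (\<forall>n. adj T (\<rho> n) (\<rho> (Suc n)) \<and> \<rho> n \<noteq> \<rho> (Suc (Suc n)))"

lemma nb_ray_Cons: "nb_ray T \<rho> \<Longrightarrow> adj T v (\<rho> 0) \<Longrightarrow> v \<noteq> \<rho> 1 \<Longrightarrow> nb_ray T (case_nat v \<rho>)"
  unfolding nb_ray_def by (intro allI, case_tac n) auto

locale double_ray_root = tree_with_root T w for T :: "'v graph" and w +
  fixes r\<^sub>1 r\<^sub>2 :: "nat \<Rightarrow> 'v"
  assumes rays: "nb_ray T r\<^sub>1" "nb_ray T r\<^sub>2" "r\<^sub>1 0 = w" "r\<^sub>2 0 = w" "r\<^sub>1 1 \<noteq> r\<^sub>2 1"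
begin

text \<open>Each step goes to the parent or to a child. After arriving from the parent, a step back
  there would be backtracking, so the walk descends forever once its first step does.\<close>

lemma descending_ray:
  assumes \<rho>: "nb_ray T \<rho>" and start: "\<rho> 0 = w \<or> \<rho> 1 \<noteq> par (\<rho> 0)"
  shows "\<rho> n \<in> V \<and> \<rho> (Suc n) \<noteq> w \<and> par (\<rho> (Suc n)) = \<rho> n"
proof (induction n)
  case 0
  have "adj T (\<rho> 0) (\<rho> 1)"
    using \<rho> by (simp add: nb_ray_def)
  then show ?case
    using start by (auto simp: adj_iff)
next
  case (Suc n)
  have "adj T (\<rho> (Suc n)) (\<rho> (Suc (Suc n)))" "\<rho> n \<noteq> \<rho> (Suc (Suc n))"
    using \<rho> by (simp_all add: nb_ray_def)
  then show ?case
    using Suc by (auto simp: adj_iff)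
qed

lemma descending_ray_core:
  assumes "nb_ray T \<rho>" "\<rho> 0 = w \<or> \<rho> 1 \<noteq> par (\<rho> 0)"
  shows "\<rho> n \<in> core"
  unfolding core_def
  using descending_ray[OF assms] by (intro CollectI exI[of _ "\<lambda>k. \<rho> (n + k)"]) simp

text \<open>Climb to the root, then leave along whichever of the two given rays avoids the neighbour
  just passed.\<close>

lemma ascending_ray: "v \<in> V \<Longrightarrow> v \<noteq> w \<Longrightarrow> \<exists>\<rho>. nb_ray T \<rho> \<and> \<rho> 0 = v \<and> \<rho> 1 = par v"
proof (induction "lev v" arbitrary: v)
  case (Suc n)
  have adj: "adj T v (par v)" and lev: "lev v = Suc (lev (par v))"
    using par[OF Suc.prems] adjD by blast+
  have "\<exists>\<rho>. nb_ray T \<rho> \<and> \<rho> 0 = par v \<and> v \<noteq> \<rho> 1"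
  proof (cases "par v = w")
    case True
    then show ?thesis
      using rays by metis
  next
    case False
    then obtain \<rho> where "nb_ray T \<rho>" "\<rho> 0 = par v" "\<rho> 1 = par (par v)"
      using Suc.hyps(1)[of "par v"] Suc.hyps(2) lev par_in Suc.prems by auto
    moreover have "v \<noteq> par (par v)"
      using lev lev_par[OF par_in[OF Suc.prems(1)]] by auto
    ultimately show ?thesis by metis
  qed
  then obtain \<rho> where "nb_ray T \<rho>" "\<rho> 0 = par v" "v \<noteq> \<rho> 1"
    by blast
  then show ?case
    using nb_ray_Cons[of T \<rho> v] adj by (intro exI[of _ "case_nat v \<rho>"]) simp
qed (use lev_0 in auto)

text \<open>The right-hand side does not mention the root, which makes the core invariant under all
  automorphisms of \<open>T\<close>, also those moving \<open>w\<close>. A core vertex other than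
  \<open>w\<close> has a descending and an ascending ray; conversely, of two rays with different
  first steps one avoids the parent.\<close>

lemma core_iff:
  "v \<in> core \<longleftrightarrow> (\<exists>\<rho>\<^sub>1 \<rho>\<^sub>2. nb_ray T \<rho>\<^sub>1 \<and> nb_ray T \<rho>\<^sub>2 \<and> \<rho>\<^sub>1 0 = v \<and> \<rho>\<^sub>2 0 = v \<and> \<rho>\<^sub>1 1 \<noteq> \<rho>\<^sub>2 1)"
proof
  assume v: "v \<in> core"
  show "\<exists>\<rho>\<^sub>1 \<rho>\<^sub>2. nb_ray T \<rho>\<^sub>1 \<and> nb_ray T \<rho>\<^sub>2 \<and> \<rho>\<^sub>1 0 = v \<and> \<rho>\<^sub>2 0 = v \<and> \<rho>\<^sub>1 1 \<noteq> \<rho>\<^sub>2 1"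
  proof (cases "v = w")
    case True
    then show ?thesis
      using rays by (intro exI[of _ r\<^sub>1] exI[of _ r\<^sub>2]) simp
  next
    case False
    obtain s where s: "s 0 = v" "\<And>n. s n \<in> V \<and> s (Suc n) \<noteq> w \<and> par (s (Suc n)) = s n"
      using v by (auto simp: core_def)
    have lev: "lev (s (Suc n)) = Suc (lev (s n))" for n
      using lev_Suc[of "s (Suc n)"] s(2)[of n] s(2)[of "Suc n"] by simp
    have "nb_ray T s"
      unfolding nb_ray_def
    proof
      fix n
      have "adj T (s n) (s (Suc n))"
        using s(2)[of n] s(2)[of "Suc n"] by (simp add: adj_iff)
      moreover have "lev (s n) \<noteq> lev (s (Suc (Suc n)))"
        using lev by simp
      ultimately show "adj T (s n) (s (Suc n)) \<and> s n \<noteq> s (Suc (Suc n))"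
        by metis
    qed
    moreover obtain \<rho> where "nb_ray T \<rho>" "\<rho> 0 = v" "\<rho> 1 = par v"
      using ascending_ray[OF core_in[OF v] False] by auto
    moreover have "s 1 \<noteq> par v"
      using lev[of 0] s(1) lev_Suc[OF core_in[OF v] False] by auto
    ultimately show ?thesis
      using s(1) by (intro exI[of _ s] exI[of _ \<rho>]) simp
  qed
next
  assume "\<exists>\<rho>\<^sub>1 \<rho>\<^sub>2. nb_ray T \<rho>\<^sub>1 \<and> nb_ray T \<rho>\<^sub>2 \<and> \<rho>\<^sub>1 0 = v \<and> \<rho>\<^sub>2 0 = v \<and> \<rho>\<^sub>1 1 \<noteq> \<rho>\<^sub>2 1"
  then obtain \<rho>\<^sub>1 \<rho>\<^sub>2 where \<rho>: "nb_ray T \<rho>\<^sub>1" "nb_ray T \<rho>\<^sub>2" "\<rho>\<^sub>1 0 = v" "\<rho>\<^sub>2 0 = v" "\<rho>\<^sub>1 1 \<noteq> \<rho>\<^sub>2 1"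
    by blast
  then consider "\<rho>\<^sub>1 1 \<noteq> par v" | "\<rho>\<^sub>2 1 \<noteq> par v"
    by fastforce
  then show "v \<in> core"
    using descending_ray_core[OF \<rho>(1), of 0] descending_ray_core[OF \<rho>(2), of 0] \<rho>(3,4)
    by cases simp_all
qed

lemma core_aut:
  assumes "automorphism T \<phi>" "v \<in> core"
  shows "\<phi> v \<in> core"
proof -
  have ray: "nb_ray T (\<lambda>n. \<phi> (\<rho> n))" if "nb_ray T \<rho>" for \<rho>
    using that aut_adj[OF assms(1)] inj_onD[OF aut_inj[OF assms(1)]] adjD unfolding nb_ray_def by metis
  obtain \<rho>\<^sub>1 \<rho>\<^sub>2 where \<rho>: "nb_ray T \<rho>\<^sub>1" "nb_ray T \<rho>\<^sub>2" "\<rho>\<^sub>1 0 = v" "\<rho>\<^sub>2 0 = v" "\<rho>\<^sub>1 1 \<noteq> \<rho>\<^sub>2 1"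
    using assms(2) unfolding core_iff by blast
  have "\<rho>\<^sub>1 1 \<in> V" "\<rho>\<^sub>2 1 \<in> V"
    using \<rho>(1,2) adjD unfolding nb_ray_def by blast+
  then have "\<phi> (\<rho>\<^sub>1 1) \<noteq> \<phi> (\<rho>\<^sub>2 1)"
    using inj_onD[OF aut_inj[OF assms(1)]] \<rho>(5) by blast
  then show ?thesis
    unfolding core_iff using ray[OF \<rho>(1)] ray[OF \<rho>(2)] \<rho>(3,4)
    by (intro exI[of _ "\<lambda>n. \<phi> (\<rho>\<^sub>1 n)"] exI[of _ "\<lambda>n. \<phi> (\<rho>\<^sub>2 n)"]) simp
qed

section \<open>A pattern that identifies the root\<close>

definition mark :: "'v set" where
  "mark = {v \<in> core. lev v \<le> 1}"

text \<open>Only adjacency and the core enter, so every automorphism of \<open>T\<close> respects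
  this notion.\<close>

definition branching :: "'v set \<Rightarrow> 'v \<Rightarrow> bool" where
  "branching S v \<longleftrightarrow> v \<in> S \<inter> core \<and> (\<exists>u \<in> S \<inter> core. \<exists>u' \<in> S \<inter> core. u \<noteq> u' \<and> adj T v u \<and> adj T v u')"

lemma branching_aut:
  assumes \<phi>: "automorphism T \<phi>" and "branching S v"
  shows "branching (\<phi> ` S) (\<phi> v)"
proof -
  obtain u u' where v: "v \<in> S \<inter> core" "u \<in> S \<inter> core" "u' \<in> S \<inter> core" "u \<noteq> u'" "adj T v u" "adj T v u'"
    using assms(2) unfolding branching_def by blast
  then have "\<phi> u \<noteq> \<phi> u'"
    using inj_onD[OF aut_inj[OF \<phi>]] core_in by blast
  then show ?thesis
    unfolding branching_def using v core_aut[OF \<phi>] aut_adj[OF \<phi>] by blast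
qed

text \<open>
  The root is recognized in a marked colouring as the only vertex of the core with two black
  neighbours in the core, because the core vertices of \<open>S\<close> avoid the even levels and level \<open>1\<close>.
\<close>

lemma branching_mark_iff:
  assumes S: "\<And>v. v \<in> S \<Longrightarrow> v \<in> core \<Longrightarrow> odd (lev v) \<and> 3 \<le> lev v"
  shows "branching (S \<union> mark) v \<longleftrightarrow> v = w"
proof
  assume "v = w"
  have "r\<^sub>1 n \<in> core" "r\<^sub>2 n \<in> core" for n
    using descending_ray_core rays by blast+
  moreover have "lev (r\<^sub>1 1) = 1" "lev (r\<^sub>2 1) = 1"
    using descending_ray[of r\<^sub>1 0] descending_ray[of r\<^sub>1 1] descending_ray[of r\<^sub>2 0] descending_ray[of r\<^sub>2 1]
      rays lev_Suc[of "r\<^sub>1 1"] lev_Suc[of "r\<^sub>2 1"] lev_root by auto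
  moreover have "adj T w (r\<^sub>1 1)" "adj T w (r\<^sub>2 1)"
    using rays unfolding nb_ray_def by (metis One_nat_def)+
  ultimately show "branching (S \<union> mark) v"
    unfolding branching_def mark_def using \<open>v = w\<close> rays lev_root by (metis (mono_tags, lifting)
      IntI UnI2 mem_Collect_eq order_refl zero_le_one)
next
  have lev: "lev u \<le> 1 \<or> odd (lev u) \<and> 3 \<le> lev u" if "u \<in> (S \<union> mark) \<inter> core" for u
    using that S by (auto simp: mark_def)
  assume "branching (S \<union> mark) v"
  then obtain u u' where v: "v \<in> (S \<union> mark) \<inter> core" and u: "u \<in> (S \<union> mark) \<inter> core" "adj T v u"
    and u': "u' \<in> (S \<union> mark) \<inter> core" "adj T v u'" and "u \<noteq> u'"
    unfolding branching_def by blast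
  show "v = w"
  proof (rule ccontr)
    assume "v \<noteq> w"
    have vV: "v \<in> V"
      using v core_in by blast
    \<comment> \<open>A child of \<open>v\<close> in the coloured core would lie one level further
      out. The possible levels are 0, 1, 3, 5 and so on, and \<open>lev v\<close> is positive, so
      this cannot happen and only the parent remains.\<close>
    have "par v = z" if z: "z \<in> (S \<union> mark) \<inter> core" "adj T v z" for z
    proof (rule ccontr)
      assume "par v \<noteq> z"
      then have "z \<noteq> w" "par z = v" "z \<in> V"
        using z(2) unfolding adj_iff by auto
      then have "lev z = Suc (lev v)"
        using lev_Suc by blast
      moreover have "lev v \<noteq> 0"
        using lev_0[OF vV] \<open>v \<noteq> w\<close> by blast
      ultimately show False
        using lev[OF v] lev[OF z(1)] by (auto simp: even_Suc le_Suc_eq)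
    qed
    then show False
      using u u' \<open>u \<noteq> u'\<close> by blast
  qed
qed

end

section \<open>Counting asymmetrizing sets\<close>

lemma card_of_Pow_ctwo: "|Pow A| =o ctwo ^c |A|"
  using card_of_Pow_Func by (simp add: cexp_def ctwo_def Field_card_of)

text \<open>In the application \<open>M\<close> has the size of the motion, if that is a cardinal.
  \<open>rigid_extension\<close> is used for the whole tree; the part left free has size at least
  \<open>|V|\<close>, and its subsets give pairwise inequivalent asymmetrizing sets.\<close>

lemma (in double_ray_root) many_asymmetrizing_sets:
  fixes M :: "'b set"
  assumes M: "M \<noteq> {}"
    and mob: "\<And>x. mobile x \<Longrightarrow> infinite (desc x)" "\<And>x. mobile x \<Longrightarrow> |M| \<le>o |desc x|"
      "\<And>x. mobile x \<Longrightarrow> |sib x| \<le>o |Pow M|"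
  shows "|Pow V| \<le>o asymmetrizing_number T"
proof -
  have root_core: "w \<in> core"
    using descending_ray_core[of r\<^sub>1 0] rays by simp
  interpret rayed_action V w par lev root_aut
    using root_core mob(1) by unfold_locales
  have room: "|M| \<le>o |desc x \<inter> chan L|" if "mobile x" "infinite L" for x L
    using ordLeq_transitive[OF mob(2)[OF that(1)] desc_le_chan[OF _ that(2)]] that(1)
    by (simp add: anchors_def)
  have sib: "|sib z| \<le>o |ctypes L z|" if "mobile z" "infinite L" for z L
    using room M mob(3) that by (rule sib_le_ctypes)
  obtain L0 :: "nat set" and E where L0: "infinite L0"
    and E: "\<And>A. A \<subseteq> desc w \<inter> chan L0 \<Longrightarrow> E A \<subseteq> desc w \<inter> chan UNIV"
      "\<And>A B g. \<lbrakk>A \<subseteq> desc w \<inter> chan L0; B \<subseteq> desc w \<inter> chan L0; g \<in> root_aut; g w = w; g ` E A = E B\<rbrakk>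
        \<Longrightarrow> A = B \<and> (\<forall>v \<in> desc w. g v = v)"
    by (rule rigid_extension[OF root_in, of UNIV]) ((simp; fail), (rule sib; assumption), (rule that; assumption))
  define D where "D = desc w \<inter> chan L0"
  \<comment> \<open>\<open>mark\<close> lies in the core outside all channels, so \<open>E A\<close>
    can be recovered as \<open>S A \<inter> chan UNIV\<close>.\<close>
  define S where "S A = E A \<union> mark" for A
  have free: "odd (lev v) \<and> 3 \<le> lev v" if "v \<in> chan UNIV" "v \<in> core" for v
    using that unfolding chan_def by (simp add: free_def)
  have S_E: "S A \<inter> chan UNIV = E A" if "A \<subseteq> D" for A
    using E(1)[of A] that free unfolding S_def D_def mark_def by fastforce
  have S_V: "S A \<subseteq> V" if "A \<subseteq> D" for A
    using E(1)[of A] that desc_subset core_in unfolding S_def D_def mark_def by blast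
  have branching: "branching (S A) v \<longleftrightarrow> v = w" if "A \<subseteq> D" for A v
    unfolding S_def using E(1)[of A] that free unfolding D_def by (intro branching_mark_iff) blast
  \<comment> \<open>Recognizing the root puts \<open>\<phi>\<close> into \<open>root_aut\<close>, to
    which the rigidity of \<open>E\<close> applies.\<close>
  have rigid: "A = B \<and> (\<forall>v \<in> V. \<phi> v = v)"
    if A: "A \<subseteq> D" and B: "B \<subseteq> D" and \<phi>: "automorphism T \<phi>" "\<phi> ` S A = S B" for A B \<phi>
  proof -
    have "branching (S B) (\<phi> w)"
      using branching_aut[OF \<phi>(1), of "S A" w] branching[OF A] \<phi>(2) by simp
    then have "\<phi> w = w"
      using branching[OF B] by simp
    then have g: "\<phi> \<in> root_aut"
      using \<phi>(1) by (simp add: root_aut_def)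
    have "\<phi> ` E A = \<phi> ` (S A \<inter> chan UNIV)"
      using S_E[OF A] by simp
    also have "\<dots> = \<phi> ` S A \<inter> \<phi> ` chan UNIV"
      using inj_on_image_Int[OF act_inj[OF g] S_V[OF A] chan_subset] .
    also have "\<dots> = E B"
      using \<phi>(2) act_image_chan[OF g] S_E[OF B] by simp
    finally show ?thesis
      using E(2)[of A B \<phi>] A B g \<open>\<phi> w = w\<close> unfolding D_def desc_root by blast
  qed
  have asym: "asymmetrizing T (S A)" if "A \<subseteq> D" for A
    unfolding asymmetrizing_def moved_def using S_V[OF that] rigid[OF that that] by auto
  let ?q = "\<lambda>A. asymmetrizing_equiv T `` {S A}"
  have "inj_on ?q (Pow D)"
  proof (rule inj_onI)
    fix A B assume AB: "A \<in> Pow D" "B \<in> Pow D" "?q A = ?q B"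
    then have "(S A, S B) \<in> asymmetrizing_equiv T"
      using eq_equiv_class[OF AB(3) equiv_asymmetrizing_equiv] asym by simp
    then obtain \<phi> where "automorphism T \<phi>" "\<phi> ` S A = S B"
      unfolding asymmetrizing_equiv_def by blast
    then show "A = B"
      using rigid[of A B \<phi>] AB by simp
  qed
  moreover have "?q A \<in> {S. asymmetrizing T S} // asymmetrizing_equiv T" if "A \<in> Pow D" for A
    using asym that by (intro quotientI) simp
  ultimately have "|Pow D| \<le>o asymmetrizing_number T"
    unfolding asymmetrizing_number_def by (rule card_of_ordLeqI)
  moreover have "|V| \<le>o |D|"
    using desc_le_chan[OF _ L0, of w] root_core by (simp add: D_def desc_root anchors_def)
  ultimately show ?thesis
    using ordLeq_transitive[OF card_of_Pow_mono] by blast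
qed

lemma asymmetrizing_number_le: "asymmetrizing_number T \<le>o |Pow (verts T)|"
proof -
  let ?A = "{S. asymmetrizing T S}"
  have "?A // asymmetrizing_equiv T = (\<lambda>S. asymmetrizing_equiv T `` {S}) ` ?A"
    by (auto simp: quotient_def)
  then have "asymmetrizing_number T \<le>o |?A|"
    unfolding asymmetrizing_number_def by (simp add: card_of_image)
  moreover have "|?A| \<le>o |Pow (verts T)|"
    by (rule card_of_mono1) (auto simp: asymmetrizing_def)
  ultimately show ?thesis
    by (rule ordLeq_transitive)
qed

theorem theorem3p4:
  fixes T :: "'v graph"
  assumes "tree T"
    and "infinite_motion (motion T)"
    and "le_two_power_motion (max_degree T) (motion T)"
    and "\<exists>r. is_double_ray T r"
  shows "asymmetrizing_number T =o ctwo ^c |verts T|"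
proof -
  obtain r :: "int \<Rightarrow> 'v" where r: "inj r" "range r \<subseteq> verts T" "\<And>i. adj T (r i) (r (i + 1))"
    using assms(4) unfolding is_double_ray_def by blast
  have sym: "adj T u v \<Longrightarrow> adj T v u" for u v
    using assms(1) unfolding tree_def simple_graph_def by blast
  have r_eq: "r i = r j \<longleftrightarrow> i = j" for i j
    using r(1) by (simp add: inj_eq)
  \<comment> \<open>The double ray is cut at index 0, which becomes the root.\<close>
  interpret double_ray_root T "r 0" "\<lambda>n. r (int n)" "\<lambda>n. r (- int n)"
  proof
    show "tree T" "r 0 \<in> verts T"
      using assms(1) r(2) by auto
    have "adj T (r (int n)) (r (int (Suc n)))" for n
      using r(3)[of "int n"] by (simp add: add.commute)
    then show "nb_ray T (\<lambda>n. r (int n))"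
      by (simp add: nb_ray_def r_eq)
    have "adj T (r (- int n)) (r (- int (Suc n)))" for n
      using sym[OF r(3)[of "- int (Suc n)"]] by simp
    then show "nb_ray T (\<lambda>n. r (- int n))"
      by (simp add: nb_ray_def r_eq)
  qed (simp_all add: r_eq)
  have "|Pow V| \<le>o asymmetrizing_number T"
  proof (cases "motion T")
    case None
    \<comment> \<open>A mobile vertex would yield a nontrivial automorphism by
      \<open>mobile_swap\<close>. So no vertex is mobile, and the conditions on \<open>M\<close>
      hold vacuously.\<close>
    have "\<not> mobile x" for x
    proof
      assume "mobile x"
      then obtain \<sigma> where "automorphism T \<sigma>" "\<sigma> x \<noteq> x" "x \<in> V"
        by (rule mobile_swap)
      then show False
        using None by (auto simp: motion_def asymmetric_def moved_def split: if_splits)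
    qed
    then show ?thesis
      by (intro many_asymmetrizing_sets[of UNIV]) auto
  next
    case (Some m)
    \<comment> \<open>An automorphism attaining the motion presents \<open>m\<close> as the size of
      a set, its moved vertices.\<close>
    obtain \<phi> where m: "m = |moved T \<phi>|" and "moved T \<phi> \<noteq> {}"
      using motion_SomeD(1)[OF Some] by blast
    have inf: "cinfinite m" and deg: "max_degree T \<le>o ctwo ^c m"
      using assms(2,3) Some by simp_all
    show ?thesis
    proof (rule many_asymmetrizing_sets[OF \<open>moved T \<phi> \<noteq> {}\<close>])
      fix x assume x: "mobile x"
      show "infinite (desc x)" "|moved T \<phi>| \<le>o |desc x|"
        using motion_le_desc[OF Some inf x] by (simp_all add: m)
      have "par x \<in> V"
        using x par_in by (simp add: mobile_def)
      have "|sib x| \<le>o max_degree T"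
        using ordLeq_transitive[OF sib_le_degree[OF x] max_degree(2)[OF \<open>par x \<in> V\<close>]] .
      then have "|sib x| \<le>o ctwo ^c |moved T \<phi>|"
        using deg unfolding m by (rule ordLeq_transitive)
      then show "|sib x| \<le>o |Pow (moved T \<phi>)|"
        using ordLeq_ordIso_trans[OF _ ordIso_symmetric[OF card_of_Pow_ctwo]] by blast
    qed
  qed
  then have "asymmetrizing_number T =o |Pow V|"
    using asymmetrizing_number_le ordIso_iff_ordLeq by blast
  then show ?thesis
    using ordIso_transitive[OF _ card_of_Pow_ctwo] by blast
qed

end
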